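(* For any connected $d$-regular simple graph $G$ with $d \geq 3$, there is a natural group homomorphism $f:K(\operatorname{line} G) \rightarrow K(\operatorname{sd} G)$ whose kernel-cokernel exact sequence takes the form $$0 \rightarrow {\mathbb Z}_d^{\beta(G)-2} \oplus C \rightarrow K(\operatorname{line} G) \overset{f}{\rightarrow} K(\operatorname{sd} G) \rightarrow C \rightarrow 0$$ in which the cokernel $C$ is the following cyclic $d$-torsion group: $$C= \begin{cases} 0 & \text{ if } G \text{ is non-bipartite and }d\text{ is odd},\\ {\mathbb Z}_2 & \text{ if } G \text{ is non-bipartite and }d \text{ is even},\\ {\mathbb Z}_d & \text{ if } G \text{ is bipartite}. \end{cases}$$
   Context: $K(\cdot)$ denotes the critical group of a graph, $\beta(G)$ the number of independent cycles, $\operatorname{line} G$ the line graph of $G$, and $\operatorname{sd} G$ the edge subdivision of $G$ (obtained by inserting a new midpoint vertex $uv$ on each edge $\{u,v\}$). The map $f$ is induced by the linear map sending the edge $(uv,vw)$ of $\operatorname{line} G$ to $(uv,v)+(v,vw)$ in $\operatorname{sd} G$. *)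

theory Defs
  imports
    "Graph_Theory.Graph_Theory"
    "HOL-Algebra.Elementary_Groups"
    "HOL-Algebra.Product_Groups"
    "HOL-Library.Function_Algebras"
begin

text \<open>
  A finite simple graph is a \<^locale>\<open>pair_graph\<close>: a finite, symmetric, loopless set of arcs, in which
  an undirected edge appears as the two arcs \<open>(u, v)\<close> and \<open>(v, u)\<close>, and is named by the set
  \<open>{u, v}\<close>.
\<close>

definition edges :: "'a pair_pre_digraph \<Rightarrow> 'a set set" where
  "edges G = {{u, v} | u v. (u, v) \<in> parcs G}"

definition regular :: "nat \<Rightarrow> 'a pair_pre_digraph \<Rightarrow> bool" where
  "regular d G \<longleftrightarrow> (\<forall>v \<in> pverts G. out_degree (with_proj G) v = d)"

definition bipartite :: "'a pair_pre_digraph \<Rightarrow> bool" where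
  "bipartite G \<longleftrightarrow> (\<exists>A B. A \<union> B = pverts G \<and> A \<inter> B = {} \<and>
     (\<forall>(u, v) \<in> parcs G. (u \<in> A \<and> v \<in> B) \<or> (u \<in> B \<and> v \<in> A)))"

definition line_graph :: "'a pair_pre_digraph \<Rightarrow> 'a set pair_pre_digraph" where
  "line_graph G = \<lparr>pverts = edges G,
     parcs = {(e, e'). e \<in> edges G \<and> e' \<in> edges G \<and> e \<noteq> e' \<and> e \<inter> e' \<noteq> {}}\<rparr>"

text \<open>\<open>Inl v\<close> is an original vertex and \<open>Inr e\<close> is the midpoint of the edge \<open>e\<close>.\<close>

definition sd_graph :: "'a pair_pre_digraph \<Rightarrow> ('a + 'a set) pair_pre_digraph" where
  "sd_graph G = \<lparr>pverts = Inl ` pverts G \<union> Inr ` edges G,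
     parcs = {(Inl v, Inr e) | v e. e \<in> edges G \<and> v \<in> e}
           \<union> {(Inr e, Inl v) | v e. e \<in> edges G \<and> v \<in> e}\<rparr>"

text \<open>
  Instead of fixing an orientation of the edges, we take \<open>\<int>\<^sup>E\<close> to be the
  antisymmetric integer functions on arcs (extended by 0), so that \<open>(v, u) = - (u, v)\<close>.  The
  coefficients are left polymorphic because the cycle space is also needed over the rationals.
\<close>

definition edge_chains :: "'a pair_pre_digraph \<Rightarrow> ('a \<times> 'a \<Rightarrow> 'b::ab_group_add) set" where
  "edge_chains G = {c. (\<forall>u v. c (v, u) = - c (u, v)) \<and> (\<forall>a. a \<notin> parcs G \<longrightarrow> c a = 0)}"

definition chain_group :: "'a pair_pre_digraph \<Rightarrow> ('a \<times> 'a \<Rightarrow> int) monoid" where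
  "chain_group G = \<lparr>carrier = edge_chains G, monoid.mult = (+), one = 0\<rparr>"

definition arc_chain :: "'a \<Rightarrow> 'a \<Rightarrow> 'a \<times> 'a \<Rightarrow> int" where
  "arc_chain u v = (\<lambda>a. if a = (u, v) then 1 else if a = (v, u) then - 1 else 0)"

text \<open>
  The boundary map sends the arc \<open>(u, v)\<close> to \<open>v - u\<close>; \<open>cycles\<close> is its kernel, and \<open>bonds\<close> is the
  image of its transpose.
\<close>

definition cycles :: "'a pair_pre_digraph \<Rightarrow> ('a \<times> 'a \<Rightarrow> 'b::ab_group_add) set" where
  "cycles G = {c \<in> edge_chains G. \<forall>v \<in> pverts G. (\<Sum>u | (u, v) \<in> parcs G. c (u, v)) = 0}"

definition bonds :: "'a pair_pre_digraph \<Rightarrow> ('a \<times> 'a \<Rightarrow> 'b::ab_group_add) set" where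
  "bonds G = {\<lambda>(u, v). if (u, v) \<in> parcs G then p v - p u else 0 | p. True}"

text \<open>The number of independent cycles is the rank of the cycle lattice.\<close>

definition betti :: "'a pair_pre_digraph \<Rightarrow> nat" where
  "betti G = vector_space.dim (\<lambda>(k::rat) c a. k * c a) (cycles G :: ('a \<times> 'a \<Rightarrow> rat) set)"

definition crit_lattice :: "'a pair_pre_digraph \<Rightarrow> ('a \<times> 'a \<Rightarrow> int) set" where
  "crit_lattice G = cycles G <#>\<^bsub>chain_group G\<^esub> bonds G"

definition critical_group :: "'a pair_pre_digraph \<Rightarrow> ('a \<times> 'a \<Rightarrow> int) set monoid" where
  "critical_group G = chain_group G Mod crit_lattice G"

definition crit_class :: "'a pair_pre_digraph \<Rightarrow> ('a \<times> 'a \<Rightarrow> int) \<Rightarrow> ('a \<times> 'a \<Rightarrow> int) set" where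
  "crit_class G c = crit_lattice G #>\<^bsub>chain_group G\<^esub> c"

end

theory Submission
  imports Defs
begin

text \<open>
  A chain \<open>c\<close> of a graph lies in the lattice spanned by cycles and bonds iff its boundary is the
  boundary of a bond. The chain map \<open>sd_map\<close> preserves boundaries at the midpoints, and its image
  consists of the chains whose boundary vanishes at the original vertices.

  If \<open>sd_map c\<close> has the boundary of the bond with potential \<open>b\<close> on the midpoints and \<open>a\<close> on the
  vertices, then \<open>d * a v\<close> is the sum of \<open>b\<close> over the edges at \<open>v\<close>. The kernel of the induced map is
  therefore a quotient of the group of functions \<open>b\<close> on the edges whose star sums are divisible by
  \<open>d\<close>. A harmonicity argument shows that \<open>b\<close> is killed iff it is constant modulo \<open>d\<close>, so
  the kernel is the null space modulo \<open>d\<close> of the unsigned incidence matrix, divided by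
  the constants. A rooted spanning tree eliminates the tree edges from this system; what remains is
  one free coordinate for each of the \<open>betti G\<close> cotree edges, subject to one relation
  \<open>2 * eta = 0\<close>, which is vacuous iff \<open>G\<close> is bipartite.

  The cokernel is detected by the sum of the boundary over the vertices, weighted by the parity
  of their distance to the root, taken modulo \<open>d\<close>, \<open>2\<close> or \<open>1\<close>.
\<close>

section \<open>Critical groups as quotients of chain groups\<close>

text \<open>Both images are \<open>M\<close> modulo the same subgroup, so \<open>q x\<close>
  determines \<open>h x\<close> and conversely. The embedding arises without choosing generators of
  \<open>A\<close>.\<close>

lemma mon_from_common_kernel:
  assumes q: "group_hom M A q" and h: "group_hom M K h"
    and surj: "q ` carrier M = carrier A"
    and ker: "\<And>x. x \<in> carrier M \<Longrightarrow> q x = \<one>\<^bsub>A\<^esub> \<longleftrightarrow> h x = \<one>\<^bsub>K\<^esub>"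
  obtains i where "i \<in> mon A K" "i ` carrier A = h ` carrier M"
proof -
  interpret q: group_hom M A q by (fact q)
  interpret h: group_hom M K h by (fact h)
  have eq_iff: "q x = q y \<longleftrightarrow> h x = h y" if "x \<in> carrier M" "y \<in> carrier M" for x y
  proof -
    have "q x = q y \<longleftrightarrow> q (x \<otimes>\<^bsub>M\<^esub> inv\<^bsub>M\<^esub> y) = \<one>\<^bsub>A\<^esub>"
      using that by (simp add: q.H.inv_solve_right')
    also have "\<dots> \<longleftrightarrow> h (x \<otimes>\<^bsub>M\<^esub> inv\<^bsub>M\<^esub> y) = \<one>\<^bsub>K\<^esub>"
      using that by (intro ker) auto
    also have "\<dots> \<longleftrightarrow> h x = h y"
      using that by (simp add: h.H.inv_solve_right')
    finally show ?thesis .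
  qed
  obtain i where i: "\<And>x. x \<in> carrier M \<Longrightarrow> h x = i (q x)"
    using function_factors_left_gen [of "\<lambda>x. x \<in> carrier M" q h] eq_iff by blast
  have "i \<in> hom A K"
  proof (rule homI)
    fix a assume "a \<in> carrier A"
    then obtain x where "x \<in> carrier M" "a = q x" using surj by blast
    then show "i a \<in> carrier K" using i by (metis h.hom_closed)
  next
    fix a b assume "a \<in> carrier A" "b \<in> carrier A"
    then obtain x y where "x \<in> carrier M" "a = q x" "y \<in> carrier M" "b = q y"
      using surj by blast
    then show "i (a \<otimes>\<^bsub>A\<^esub> b) = i a \<otimes>\<^bsub>K\<^esub> i b"
      using i by (metis h.hom_mult q.hom_mult q.G.m_closed)
  qed
  moreover have "inj_on i (carrier A)"
    using eq_iff i by (auto simp: inj_on_def simp flip: surj)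
  moreover have "i ` carrier A = h ` carrier M"
    using i by (force simp flip: surj)
  ultimately show thesis
    using that by (simp add: mon_def)
qed

section \<open>Boundaries and coboundaries of chains\<close>

definition boundary :: "'a pair_pre_digraph \<Rightarrow> ('a \<times> 'a \<Rightarrow> 'b::ab_group_add) \<Rightarrow> 'a \<Rightarrow> 'b" where
  "boundary H c v = (\<Sum>u | (u, v) \<in> parcs H. c (u, v))"

text \<open>\<open>boundary H (coboundary H p)\<close> is the graph Laplacian applied to
  \<open>p\<close>.\<close>

definition coboundary :: "'a pair_pre_digraph \<Rightarrow> ('a \<Rightarrow> 'b::ab_group_add) \<Rightarrow> 'a \<times> 'a \<Rightarrow> 'b" where
  "coboundary H p = (\<lambda>(u, v). if (u, v) \<in> parcs H then p v - p u else 0)"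

lemma boundary_add: "boundary H (c + c') v = boundary H c v + boundary H c' v"
  by (simp add: boundary_def sum.distrib)

lemma boundary_uminus: "boundary H (- c) v = - boundary H c v"
  by (simp add: boundary_def sum_negf)

lemma boundary_diff: "boundary H (c - c') v = boundary H c v - boundary H c' v"
  by (simp add: boundary_def sum_subtractf)

lemma boundary_zero: "boundary H 0 v = 0"
  by (simp add: boundary_def)

lemma coboundary_add: "coboundary H (p + q) = coboundary H p + coboundary H q"
  by (auto simp: coboundary_def)

lemma coboundary_uminus: "coboundary H (- p) = - coboundary H p"
  by (auto simp: coboundary_def)

lemma coboundary_zero: "coboundary H 0 = 0"
  by (auto simp: coboundary_def)

lemma bonds_eq: "bonds H = range (coboundary H)"
  by (auto simp: bonds_def coboundary_def)

lemma cycles_iff: "c \<in> cycles H \<longleftrightarrow> c \<in> edge_chains H \<and> (\<forall>v\<in>pverts H. boundary H c v = 0)"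
  by (simp add: cycles_def boundary_def)

lemma edge_chainsI:
  "(\<And>u v. c (v, u) = - c (u, v)) \<Longrightarrow> (\<And>a. a \<notin> parcs H \<Longrightarrow> c a = 0) \<Longrightarrow> c \<in> edge_chains H"
  unfolding edge_chains_def by blast

lemma edge_chains_antisym: "c \<in> edge_chains H \<Longrightarrow> c (v, u) = - c (u, v)"
  unfolding edge_chains_def by blast

lemma edge_chains_support: "c \<in> edge_chains H \<Longrightarrow> a \<notin> parcs H \<Longrightarrow> c a = 0"
  unfolding edge_chains_def by blast

lemma zero_edge_chains: "0 \<in> edge_chains H"
  by (simp add: edge_chains_def)

lemma add_edge_chains:
  assumes "c \<in> edge_chains H" "c' \<in> edge_chains H"
  shows "c + c' \<in> edge_chains H"
proof (rule edge_chainsI)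
  show "(c + c') (v, u) = - (c + c') (u, v)" for u v
    using edge_chains_antisym [OF assms(1), of v u] edge_chains_antisym [OF assms(2), of v u] by simp
qed (simp add: edge_chains_support [OF assms(1)] edge_chains_support [OF assms(2)])

lemma uminus_edge_chains:
  assumes "c \<in> edge_chains H"
  shows "- c \<in> edge_chains H"
proof (rule edge_chainsI)
  show "(- c) (v, u) = - (- c) (u, v)" for u v
    using edge_chains_antisym [OF assms, of v u] by simp
qed (simp add: edge_chains_support [OF assms])

lemma diff_edge_chains:
  assumes "c \<in> edge_chains H" "c' \<in> edge_chains H"
  shows "c - c' \<in> edge_chains H"
  using add_edge_chains [OF assms(1) uminus_edge_chains [OF assms(2)]] by simp

lemma coboundary_edge_chains:
  assumes "sym (parcs H)"
  shows "coboundary H p \<in> edge_chains H"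
proof -
  have "(v, u) \<in> parcs H \<longleftrightarrow> (u, v) \<in> parcs H" for u v
    using assms by (meson symE)
  then show ?thesis
    by (intro edge_chainsI) (auto simp: coboundary_def)
qed

section \<open>The group of chains and its lattice of cycles and bonds\<close>

lemma carrier_chain_group [simp]: "carrier (chain_group H) = edge_chains H"
  and mult_chain_group [simp]: "x \<otimes>\<^bsub>chain_group H\<^esub> y = x + y"
  and one_chain_group [simp]: "\<one>\<^bsub>chain_group H\<^esub> = 0"
  by (simp_all add: chain_group_def)

lemma comm_group_chain_group: "comm_group (chain_group H)"
proof (rule comm_groupI)
  fix x assume "x \<in> carrier (chain_group H)"
  then show "\<exists>y\<in>carrier (chain_group H). y \<otimes>\<^bsub>chain_group H\<^esub> x = \<one>\<^bsub>chain_group H\<^esub>"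
    by (intro bexI [of _ "- x"]) (auto simp: uminus_edge_chains)
qed (auto simp: add_edge_chains zero_edge_chains add_ac)

lemma group_chain_group: "group (chain_group H)"
  using comm_group_chain_group by (rule comm_group.axioms)

lemma inv_chain_group:
  "x \<in> edge_chains H \<Longrightarrow> inv\<^bsub>chain_group H\<^esub> x = - x"
  by (intro group.inv_equality [OF group_chain_group]) (auto simp: uminus_edge_chains)

text \<open>Cycles are the chains with zero boundary, so membership depends on the boundary alone.
  Later arguments thus solve Laplacian equations instead of decomposing chains.\<close>

lemma crit_lattice_iff:
  assumes "sym (parcs H)"
  shows "c \<in> crit_lattice H \<longleftrightarrow> c \<in> edge_chains H \<and>
    (\<exists>p. \<forall>v\<in>pverts H. boundary H c v = boundary H (coboundary H p) v)"
proof
  assume "c \<in> crit_lattice H"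
  then obtain z p where "z \<in> cycles H" "c = z + coboundary H p"
    by (auto simp: crit_lattice_def set_mult_def bonds_eq)
  then show "c \<in> edge_chains H \<and> (\<exists>p. \<forall>v\<in>pverts H. boundary H c v = boundary H (coboundary H p) v)"
    by (auto simp: cycles_iff boundary_add add_edge_chains coboundary_edge_chains [OF assms])
next
  assume R: "c \<in> edge_chains H \<and> (\<exists>p. \<forall>v\<in>pverts H. boundary H c v = boundary H (coboundary H p) v)"
  then obtain p where "\<forall>v\<in>pverts H. boundary H c v = boundary H (coboundary H p) v" by blast
  then have "c - coboundary H p \<in> cycles H"
    using R by (simp add: cycles_iff boundary_diff diff_edge_chains coboundary_edge_chains [OF assms])
  then have "(c - coboundary H p) + coboundary H p \<in> crit_lattice H"
    unfolding crit_lattice_def set_mult_def bonds_eq mult_chain_group by blast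
  then show "c \<in> crit_lattice H" by simp
qed

lemma cycle_in_crit_lattice:
  assumes "sym (parcs H)" "c \<in> edge_chains H" "\<And>v. v \<in> pverts H \<Longrightarrow> boundary H c v = 0"
  shows "c \<in> crit_lattice H"
  using assms by (auto simp: crit_lattice_iff coboundary_zero boundary_zero intro!: exI [of _ 0])

lemma coboundary_in_crit_lattice:
  "sym (parcs H) \<Longrightarrow> coboundary H p \<in> crit_lattice H"
  by (auto simp: crit_lattice_iff coboundary_edge_chains)

lemma add_crit_lattice:
  assumes "sym (parcs H)" "c \<in> crit_lattice H" "c' \<in> crit_lattice H"
  shows "c + c' \<in> crit_lattice H"
proof -
  obtain p p' where "\<forall>v\<in>pverts H. boundary H c v = boundary H (coboundary H p) v"
    "\<forall>v\<in>pverts H. boundary H c' v = boundary H (coboundary H p') v"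
    using assms crit_lattice_iff by blast
  then show ?thesis
    using assms by (auto simp: crit_lattice_iff boundary_add coboundary_add add_edge_chains
        intro!: exI [of _ "p + p'"])
qed

lemma uminus_crit_lattice:
  assumes "sym (parcs H)" "c \<in> crit_lattice H"
  shows "- c \<in> crit_lattice H"
proof -
  obtain p where "\<forall>v\<in>pverts H. boundary H c v = boundary H (coboundary H p) v"
    using assms crit_lattice_iff by blast
  then show ?thesis
    using assms by (auto simp: crit_lattice_iff boundary_uminus coboundary_uminus uminus_edge_chains
        intro!: exI [of _ "- p"])
qed

lemma crit_lattice_normal:
  assumes "sym (parcs H)"
  shows "crit_lattice H \<lhd> chain_group H"
proof -
  interpret comm_group "chain_group H" by (rule comm_group_chain_group)
  have "subgroup (crit_lattice H) (chain_group H)"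
  proof (rule subgroupI)
    show "crit_lattice H \<subseteq> carrier (chain_group H)"
      using assms by (auto simp: crit_lattice_iff)
    then show "inv\<^bsub>chain_group H\<^esub> c \<in> crit_lattice H" if "c \<in> crit_lattice H" for c
      using that assms by (simp add: subset_iff inv_chain_group uminus_crit_lattice)
    show "crit_lattice H \<noteq> {}"
      using coboundary_in_crit_lattice [OF assms] by blast
  qed (simp add: add_crit_lattice assms)
  then show ?thesis
    by (simp add: normal_iff_subgroup)
qed

section \<open>Classes in the critical group\<close>

lemma group_critical_group: "sym (parcs H) \<Longrightarrow> group (critical_group H)"
  unfolding critical_group_def by (intro normal.factorgroup_is_group crit_lattice_normal)

lemma crit_class_hom:
  "sym (parcs H) \<Longrightarrow> crit_class H \<in> hom (chain_group H) (critical_group H)"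
  using normal.r_coset_hom_Mod [OF crit_lattice_normal]
  by (simp add: critical_group_def crit_class_def [abs_def])

lemma crit_class_add:
  assumes "sym (parcs H)" "c \<in> edge_chains H" "c' \<in> edge_chains H"
  shows "crit_class H (c + c') = crit_class H c \<otimes>\<^bsub>critical_group H\<^esub> crit_class H c'"
  using hom_mult [OF crit_class_hom [OF assms(1)], of c c'] assms by simp

lemma carrier_critical_group: "carrier (critical_group H) = crit_class H ` edge_chains H"
  by (auto simp: critical_group_def crit_class_def carrier_FactGroup)

lemma crit_class_eq_iff:
  assumes "sym (parcs H)" "c \<in> edge_chains H" "c' \<in> edge_chains H"
  shows "crit_class H c = crit_class H c' \<longleftrightarrow> c - c' \<in> crit_lattice H"
proof -
  interpret normal "crit_lattice H" "chain_group H" by (rule crit_lattice_normal [OF assms(1)])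
  have c: "c \<in> carrier (chain_group H)" "c' \<in> carrier (chain_group H)"
    using assms by simp_all
  have "crit_class H c = crit_class H c' \<longleftrightarrow> c \<otimes>\<^bsub>chain_group H\<^esub> inv\<^bsub>chain_group H\<^esub> c' \<in> crit_lattice H"
    unfolding crit_class_def
  proof
    assume "crit_lattice H #>\<^bsub>chain_group H\<^esub> c = crit_lattice H #>\<^bsub>chain_group H\<^esub> c'"
    then have "c \<in> crit_lattice H #>\<^bsub>chain_group H\<^esub> c'"
      using rcos_self [OF c(1) subgroup_axioms] by simp
    then show "c \<otimes>\<^bsub>chain_group H\<^esub> inv\<^bsub>chain_group H\<^esub> c' \<in> crit_lattice H"
      by (rule rcos_module_imp [OF is_group c(2)])
  next
    assume "c \<otimes>\<^bsub>chain_group H\<^esub> inv\<^bsub>chain_group H\<^esub> c' \<in> crit_lattice H"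
    then have "c \<in> crit_lattice H #>\<^bsub>chain_group H\<^esub> c'"
      by (rule rcos_module_rev [OF is_group c(2) c(1)])
    then show "crit_lattice H #>\<^bsub>chain_group H\<^esub> c = crit_lattice H #>\<^bsub>chain_group H\<^esub> c'"
      using repr_independence [OF _ c(2) subgroup_axioms] by simp
  qed
  then show ?thesis using assms by (simp add: inv_chain_group)
qed

lemma crit_class_eq_one_iff:
  assumes "sym (parcs H)" "c \<in> edge_chains H"
  shows "crit_class H c = \<one>\<^bsub>critical_group H\<^esub> \<longleftrightarrow> c \<in> crit_lattice H"
proof -
  have "crit_class H 0 = \<one>\<^bsub>critical_group H\<^esub>"
    using hom_one [OF crit_class_hom group_chain_group group_critical_group] assms by simp
  then show ?thesis
    using crit_class_eq_iff [OF assms zero_edge_chains] by simp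
qed

section \<open>The chain map from the line graph to the subdivision\<close>

locale regular_graph =
  fixes G :: "'a pair_pre_digraph" and d :: nat
  assumes pair_graph: "pair_graph G"
    and connected: "Digraph_Component.connected (with_proj G)"
    and regular: "regular d G"
    and degree_ge_3: "d \<ge> 3"
begin

section \<open>Edges, stars and connectivity of a regular graph\<close>

abbreviation V where "V \<equiv> pverts G"

abbreviation E where "E \<equiv> edges G"

definition star :: "'a \<Rightarrow> 'a set set" where
  "star v = {e \<in> E. v \<in> e}"

lemma finite_V: "finite V"
  and arc_fst: "(u, v) \<in> parcs G \<Longrightarrow> u \<in> V"
  and arc_snd: "(u, v) \<in> parcs G \<Longrightarrow> v \<in> V"
  and arc_neq: "(u, v) \<in> parcs G \<Longrightarrow> u \<noteq> v"
  and finite_arcs: "finite (parcs G)"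
proof -
  interpret pair_graph G by (fact pair_graph)
  show "finite V" "finite (parcs G)"
    by (fact pair_finite_verts, fact pair_finite_arcs)
  show "(u, v) \<in> parcs G \<Longrightarrow> u \<in> V" "(u, v) \<in> parcs G \<Longrightarrow> v \<in> V" "(u, v) \<in> parcs G \<Longrightarrow> u \<noteq> v"
    using arc_fst_in_verts arc_snd_in_verts pair_no_loops by fastforce+
qed

lemma arc_sym: "(u, v) \<in> parcs G \<longleftrightarrow> (v, u) \<in> parcs G"
proof -
  interpret pair_graph G by (fact pair_graph)
  show ?thesis
    using pair_sym_arcs unfolding symmetric_def with_proj_simps by (meson symE)
qed

lemma edge_iff_arc: "{u, v} \<in> E \<longleftrightarrow> (u, v) \<in> parcs G"
  using arc_sym by (auto simp: edges_def doubleton_eq_iff)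

lemma edgeE:
  assumes "e \<in> E"
  obtains u v where "e = {u, v}" "(u, v) \<in> parcs G" "u \<noteq> v" "u \<in> V" "v \<in> V"
proof -
  obtain u v where e: "e = {u, v}" "(u, v) \<in> parcs G"
    using assms unfolding edges_def by blast
  show thesis
    by (rule that [OF e arc_neq [OF e(2)] arc_fst [OF e(2)] arc_snd [OF e(2)]])
qed

lemma finite_E: "finite E"
proof -
  have "E = (\<lambda>(u, v). {u, v}) ` parcs G"
    by (auto simp: edges_def)
  then show ?thesis using finite_arcs by simp
qed

lemma finite_star: "finite (star v)"
  using finite_E by (auto simp: star_def)

lemma mem_star_iff: "e \<in> star v \<longleftrightarrow> e \<in> E \<and> v \<in> e"
  by (simp add: star_def)

lemma card_star:
  assumes "v \<in> V"
  shows "card (star v) = d"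
proof -
  interpret pair_graph G by (fact pair_graph)
  have "bij_betw (\<lambda>(v, u). {v, u}) (out_arcs (with_proj G) v) (star v)"
    unfolding bij_betw_def
  proof
    show "inj_on (\<lambda>(v, u). {v, u}) (out_arcs (with_proj G) v)"
      by (auto simp: inj_on_def doubleton_eq_iff)
    show "(\<lambda>(v, u). {v, u}) ` out_arcs (with_proj G) v = star v"
    proof
      show "star v \<subseteq> (\<lambda>(v, u). {v, u}) ` out_arcs (with_proj G) v"
      proof
        fix e assume "e \<in> star v"
        then obtain u where "e = {v, u}" "(v, u) \<in> parcs G"
          using arc_sym unfolding mem_star_iff by (auto elim!: edgeE)
        then show "e \<in> (\<lambda>(v, u). {v, u}) ` out_arcs (with_proj G) v"
          by (intro image_eqI [of _ _ "(v, u)"]) auto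
      qed
    qed (auto simp: mem_star_iff edge_iff_arc)
  qed
  then have "card (star v) = out_degree (with_proj G) v"
    by (simp add: out_degree_def bij_betw_same_card)
  then show ?thesis
    using regular assms by (simp add: regular_def)
qed

lemma connected_induct:
  assumes "r \<in> V" "v \<in> V" "P r" "\<And>u v. P u \<Longrightarrow> (u, v) \<in> parcs G \<Longrightarrow> P v"
  shows "P v"
proof -
  interpret pair_graph G by (fact pair_graph)
  \<comment> \<open>Connectivity refers to the symmetric closure of the arcs, which here is the arc
    set itself.\<close>
  have "(r, v) \<in> rtrancl_on V (parcs G)"
    using connected assms(1,2) adj_mk_symmetric_eq [OF pair_sym_arcs]
    by (auto simp: Digraph_Component.connected_def strongly_connected_def reachable_def)
  then show ?thesis
    using assms(3) by induction (auto intro: assms(4))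
qed

lemma V_nonempty: "V \<noteq> {}"
  using connected by (simp add: Digraph_Component.connected_def strongly_connected_def)

text \<open>Double counting of flags, the pairs of an edge and one of its ends.\<close>

lemma sum_star_eq_sum_edge:
  fixes F :: "'a \<Rightarrow> 'a set \<Rightarrow> 'b::comm_monoid_add"
  shows "(\<Sum>v\<in>V. \<Sum>e\<in>star v. F v e) = (\<Sum>e\<in>E. \<Sum>v\<in>e. F v e)"
proof -
  have "(\<Sum>v\<in>V. \<Sum>e\<in>star v. F v e) = (\<Sum>e\<in>E. \<Sum>v\<in>{v\<in>V. v \<in> e}. F v e)"
    unfolding star_def by (rule sum.swap_restrict [OF finite_V finite_E])
  also have "\<dots> = (\<Sum>e\<in>E. \<Sum>v\<in>e. F v e)"
    by (intro sum.cong refl) (auto elim!: edgeE)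
  finally show ?thesis .
qed

text \<open>Distinct edges of a simple graph meet in at most one vertex. Hence each arc of the line
  graph belongs to the clique of exactly one vertex of \<open>G\<close>.\<close>

lemma edges_common_vertex:
  assumes "e \<in> star v" "e \<in> star w" "e' \<in> star v" "e' \<in> star w" "e \<noteq> e'"
  shows "v = w"
  using assms unfolding mem_star_iff by (auto elim!: edgeE)

lemma finite_edge: "e \<in> E \<Longrightarrow> finite e"
  by (auto elim: edgeE)

lemma edge_subset: "e \<in> E \<Longrightarrow> e \<subseteq> V"
  by (auto elim: edgeE)

section \<open>Arcs and boundaries in the line graph and the subdivision\<close>

lemma sym_line: "sym (parcs (line_graph G))"
  by (auto simp: sym_def line_graph_def)

lemma sym_sd: "sym (parcs (sd_graph G))"
  by (auto simp: sym_def sd_graph_def)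

lemma pverts_line: "pverts (line_graph G) = E"
  by (simp add: line_graph_def)

lemma line_arc_iff: "(e, e') \<in> parcs (line_graph G) \<longleftrightarrow> e \<noteq> e' \<and> (\<exists>v. e \<in> star v \<and> e' \<in> star v)"
  by (auto simp: line_graph_def mem_star_iff)

lemma sd_arc_iff:
  "(Inl v, Inr e) \<in> parcs (sd_graph G) \<longleftrightarrow> e \<in> star v"
  "(Inr e, Inl v) \<in> parcs (sd_graph G) \<longleftrightarrow> e \<in> star v"
  "(Inl v, Inl w) \<notin> parcs (sd_graph G)"
  "(Inr e, Inr e') \<notin> parcs (sd_graph G)"
  by (auto simp: sd_graph_def mem_star_iff)

lemma boundary_sd_Inl: "boundary (sd_graph G) c (Inl v) = (\<Sum>e\<in>star v. c (Inr e, Inl v))"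
proof -
  have "{x. (x, Inl v) \<in> parcs (sd_graph G)} = Inr ` star v"
    by (auto simp: sd_graph_def mem_star_iff)
  then show ?thesis
    by (simp add: boundary_def sum.reindex)
qed

lemma boundary_sd_Inr:
  assumes "e \<in> E"
  shows "boundary (sd_graph G) c (Inr e) = (\<Sum>v\<in>e. c (Inl v, Inr e))"
proof -
  have "{x. (x, Inr e) \<in> parcs (sd_graph G)} = Inl ` e"
    using assms by (auto simp: sd_graph_def)
  then show ?thesis
    by (simp add: boundary_def sum.reindex)
qed

text \<open>The neighbours of \<open>e\<close> form the two stars at its ends without
  \<open>e\<close>, and these are disjoint. Since \<open>g e = 0\<close>, \<open>e\<close> may be
  put back into both.\<close>

lemma sum_line_neighbours:
  assumes "e \<in> E" "g e = 0"
  shows "(\<Sum>e' | (e', e) \<in> parcs (line_graph G). g e') = (\<Sum>v\<in>e. \<Sum>e'\<in>star v. g e')"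
proof -
  obtain u v where e: "e = {u, v}" "u \<noteq> v"
    using assms(1) by (auto elim: edgeE)
  have "{e'. (e', e) \<in> parcs (line_graph G)} = (star u - {e}) \<union> (star v - {e})"
    using assms(1) e by (auto simp: line_graph_def mem_star_iff)
  moreover have "(star u - {e}) \<inter> (star v - {e}) = {}"
  proof -
    have "e \<in> star u" "e \<in> star v"
      using assms(1) e by (auto simp: mem_star_iff)
    then show ?thesis
      using edges_common_vertex [of e u v] e(2) by blast
  qed
  ultimately have "(\<Sum>e' | (e', e) \<in> parcs (line_graph G). g e') =
      (\<Sum>e'\<in>star u - {e}. g e') + (\<Sum>e'\<in>star v - {e}. g e')"
    by (simp add: sum.union_disjoint finite_star)
  also have "\<dots> = (\<Sum>e'\<in>star u. g e') + (\<Sum>e'\<in>star v. g e')"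
    using assms by (intro arg_cong2 [of _ _ _ _ "(+)"] sum.mono_neutral_left) (auto simp: finite_star)
  finally show ?thesis using e by simp
qed

lemma line_chain_diag: "c \<in> edge_chains (line_graph G) \<Longrightarrow> c (e, e) = 0"
  by (rule edge_chains_support) (auto simp: line_arc_iff)

lemma boundary_line:
  assumes "c \<in> edge_chains (line_graph G)" "e \<in> E"
  shows "boundary (line_graph G) c e = (\<Sum>v\<in>e. \<Sum>e'\<in>star v. c (e', e))"
  unfolding boundary_def
  using assms line_chain_diag by (intro sum_line_neighbours [where g = "\<lambda>e'. c (e', e)"]) auto

lemma boundary_line_coboundary:
  assumes "e \<in> E"
  shows "boundary (line_graph G) (coboundary (line_graph G) p) e = (\<Sum>v\<in>e. \<Sum>e'\<in>star v. p e - p e')"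
  using sum_line_neighbours [OF assms, of "\<lambda>e'. p e - p e'"]
  by (simp add: boundary_def coboundary_def)

section \<open>Chains given on flags, and the chain map\<close>

fun flag_chain :: "('a set \<Rightarrow> 'a \<Rightarrow> int) \<Rightarrow> ('a + 'a set) \<times> ('a + 'a set) \<Rightarrow> int" where
  "flag_chain y (Inr e, Inl v) = (if e \<in> star v then y e v else 0)"
| "flag_chain y (Inl v, Inr e) = (if e \<in> star v then - y e v else 0)"
| "flag_chain y (Inl v, Inl w) = 0"
| "flag_chain y (Inr e, Inr e') = 0"

lemma flag_chain_edge_chains: "flag_chain y \<in> edge_chains (sd_graph G)"
proof (rule edge_chainsI)
  show "flag_chain y (b, a) = - flag_chain y (a, b)" for a b
    by (cases a; cases b) auto
  show "flag_chain y a = 0" if "a \<notin> parcs (sd_graph G)" for a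
    using that by (cases "(y, a)" rule: flag_chain.cases) (auto simp: sd_arc_iff)
qed

text \<open>Every arc of the subdivision, or its reverse, leads from a midpoint to an original
  vertex, so antisymmetry determines a chain from its values on flags.\<close>

lemma sd_chain_eqI:
  assumes "c \<in> edge_chains (sd_graph G)" "c' \<in> edge_chains (sd_graph G)"
    and eq: "\<And>e v. e \<in> star v \<Longrightarrow> c (Inr e, Inl v) = c' (Inr e, Inl v)"
  shows "c = c'"
proof
  fix a
  show "c a = c' a"
  proof (cases "a \<in> parcs (sd_graph G)")
    case True
    then obtain v e where "e \<in> star v" "a = (Inl v, Inr e) \<or> a = (Inr e, Inl v)"
      by (auto simp: sd_graph_def mem_star_iff)
    then show ?thesis
      using eq edge_chains_antisym [OF assms(1), of "Inl v" "Inr e"]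
        edge_chains_antisym [OF assms(2), of "Inl v" "Inr e"] by auto
  qed (simp add: edge_chains_support [OF assms(1)] edge_chains_support [OF assms(2)])
qed

text \<open>A value \<open>c (e, e')\<close> with both edges at \<open>v\<close> is flow through
  \<open>v\<close>, so the flag from \<open>e\<close> to \<open>v\<close> collects the net flow
  leaving \<open>e\<close> inside the clique at \<open>v\<close>. This closed form spares the choice
  of a basis of arcs.\<close>

definition sd_map :: "('a set \<times> 'a set \<Rightarrow> int) \<Rightarrow> ('a + 'a set) \<times> ('a + 'a set) \<Rightarrow> int" where
  "sd_map c = flag_chain (\<lambda>e v. \<Sum>e'\<in>star v. c (e, e'))"

lemma sd_map_apply: "e \<in> star v \<Longrightarrow> sd_map c (Inr e, Inl v) = (\<Sum>e'\<in>star v. c (e, e'))"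
  by (simp add: sd_map_def)

lemma sd_map_edge_chains: "sd_map c \<in> edge_chains (sd_graph G)"
  by (simp add: sd_map_def flag_chain_edge_chains)

lemma sd_map_add: "sd_map (c + c') = sd_map c + sd_map c'"
  by (intro sd_chain_eqI add_edge_chains sd_map_edge_chains) (simp add: sd_map_apply sum.distrib)

lemma sd_map_diff: "sd_map (c - c') = sd_map c - sd_map c'"
  by (intro sd_chain_eqI diff_edge_chains sd_map_edge_chains) (simp add: sd_map_apply sum_subtractf)

lemma sd_map_hom: "sd_map \<in> hom (chain_group (line_graph G)) (chain_group (sd_graph G))"
  by (auto intro!: homI simp: sd_map_edge_chains sd_map_add)

lemma arc_chain_edge_chains:
  assumes "(u, v) \<in> parcs H" "sym (parcs H)" "u \<noteq> v"
  shows "arc_chain u v \<in> edge_chains H"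
proof (rule edge_chainsI)
  show "arc_chain u v (b, a) = - arc_chain u v (a, b)" for a b
    using assms(3) by (auto simp: arc_chain_def)
  show "arc_chain u v a = 0" if "a \<notin> parcs H" for a
    using that assms(1) symD [OF assms(2,1)] by (auto simp: arc_chain_def)
qed

text \<open>\<open>v\<close> is the only vertex whose star contains both edges, so the arc
  contributes to the flags at no other vertex. This ties the closed form to the prescription on
  generators.\<close>

lemma sd_map_arc_chain:
  assumes "(u, v) \<in> parcs G" "(v, w) \<in> parcs G" "u \<noteq> w"
  shows "sd_map (arc_chain {u, v} {v, w}) =
    arc_chain (Inr {u, v}) (Inl v) + arc_chain (Inl v) (Inr {v, w})"
proof (rule sd_chain_eqI)
  have e: "{u, v} \<in> star v" "{v, w} \<in> star v" and neq: "{u, v} \<noteq> {v, w}"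
    using assms by (auto simp: mem_star_iff edge_iff_arc doubleton_eq_iff)
  show "arc_chain (Inr {u, v}) (Inl v) + arc_chain (Inl v) (Inr {v, w}) \<in> edge_chains (sd_graph G)"
    using e by (intro add_edge_chains arc_chain_edge_chains sym_sd) (auto simp: sd_arc_iff)
  fix e' x assume e': "e' \<in> star x"
  have *: "{u, v} \<in> star x \<Longrightarrow> {v, w} \<in> star x \<Longrightarrow> x = v"
    using edges_common_vertex [of "{u, v}" x v "{v, w}"] e neq by blast
  have "(\<Sum>f\<in>star x. arc_chain {u, v} {v, w} (e', f)) =
      (\<Sum>f\<in>star x. (if f = {v, w} then of_bool (e' = {u, v}) else 0) - (if f = {u, v} then of_bool (e' = {v, w}) else 0))"
    using neq by (intro sum.cong refl) (auto simp: arc_chain_def)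
  also have "\<dots> = of_bool (e' = {u, v} \<and> {v, w} \<in> star x) - of_bool (e' = {v, w} \<and> {u, v} \<in> star x)"
    by (simp add: sum_subtractf finite_star)
  also have "\<dots> = of_bool (e' = {u, v} \<and> x = v) - of_bool (e' = {v, w} \<and> x = v)"
    using * e e' by auto
  finally show "sd_map (arc_chain {u, v} {v, w}) (Inr e', Inl x) =
      (arc_chain (Inr {u, v}) (Inl v) + arc_chain (Inl v) (Inr {v, w})) (Inr e', Inl x)"
    using e' by (simp add: sd_map_apply) (auto simp: arc_chain_def)
qed (rule sd_map_edge_chains)

text \<open>Antisymmetry of \<open>c\<close> turns the double sum over \<open>star v\<close> into
  its own negative.\<close>

lemma boundary_sd_map_Inl:
  assumes "c \<in> edge_chains (line_graph G)"
  shows "boundary (sd_graph G) (sd_map c) (Inl v) = 0"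
proof -
  let ?S = "\<Sum>e\<in>star v. \<Sum>e'\<in>star v. c (e, e')"
  have "?S = (\<Sum>e\<in>star v. \<Sum>e'\<in>star v. - c (e', e))"
    by (intro sum.cong refl edge_chains_antisym [OF assms])
  also have "\<dots> = - ?S"
    by (simp add: sum_negf sum.swap [of "\<lambda>e e'. c (e', e)"])
  finally have "?S = 0" by simp
  then show ?thesis
    by (simp add: boundary_sd_Inl sd_map_apply)
qed

text \<open>Each arc into \<open>e\<close> lies in the clique of exactly one end of
  \<open>e\<close>, and its flow reaches the midpoint through that end.\<close>

lemma boundary_sd_map_Inr:
  assumes "c \<in> edge_chains (line_graph G)" "e \<in> E"
  shows "boundary (sd_graph G) (sd_map c) (Inr e) = boundary (line_graph G) c e"
proof -
  have "(\<Sum>e'\<in>star v. c (e', e)) = - (\<Sum>e'\<in>star v. c (e, e'))" for v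
    unfolding sum_negf [symmetric] by (intro sum.cong refl edge_chains_antisym [OF assms(1)])
  then show ?thesis
    using assms by (simp add: boundary_sd_Inr boundary_line sd_map_def mem_star_iff)
qed

text \<open>If a chain of the subdivision has no boundary at \<open>Inl v\<close>, its flow through \<open>v\<close> can be
  rerouted along the clique of \<open>line G\<close> at \<open>v\<close>, here through one chosen hub edge.\<close>

definition hub :: "'a \<Rightarrow> 'a set" where
  "hub v = (SOME e. e \<in> star v)"

text \<open>Every edge \<open>e\<close> at \<open>v\<close> sends the flow
  \<open>c (Inr e, Inl v)\<close> straight to the hub of \<open>v\<close>. Distinct adjacent edges
  share a single vertex, which the sum over \<open>e \<inter> e'\<close> selects.\<close>

definition star_lift :: "(('a + 'a set) \<times> ('a + 'a set) \<Rightarrow> int) \<Rightarrow> 'a set \<times> 'a set \<Rightarrow> int" where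
  "star_lift c = (\<lambda>(e, e'). if (e, e') \<in> parcs (line_graph G) then
     \<Sum>v\<in>e \<inter> e'. of_bool (e' = hub v) * c (Inr e, Inl v) - of_bool (e = hub v) * c (Inr e', Inl v)
     else 0)"

lemma star_lift_edge_chains: "star_lift c \<in> edge_chains (line_graph G)"
proof (rule edge_chainsI)
  have "(e, e') \<in> parcs (line_graph G) \<longleftrightarrow> (e', e) \<in> parcs (line_graph G)" for e e'
    by (auto simp: line_arc_iff)
  then show "star_lift c (e', e) = - star_lift c (e, e')" for e e'
    by (simp add: star_lift_def Int_commute flip: sum_negf)
qed (auto simp: star_lift_def)

text \<open>An edge other than the hub sends out exactly its own flag value. The hub receives all of
  these, and as the star sum vanishes, its net outflow is its own flag value too.\<close>

lemma sd_map_star_lift: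
  assumes c: "c \<in> edge_chains (sd_graph G)"
    and bd: "\<And>v. v \<in> V \<Longrightarrow> boundary (sd_graph G) c (Inl v) = 0"
  shows "sd_map (star_lift c) = c"
proof (rule sd_chain_eqI [OF sd_map_edge_chains c])
  fix e v assume e: "e \<in> star v"
  then have v: "v \<in> V"
    using edge_subset by (auto simp: mem_star_iff)
  have hub: "hub v \<in> star v"
    unfolding hub_def by (rule someI) (fact e)
  let ?y = "\<lambda>e. c (Inr e, Inl v)"
  \<comment> \<open>The formula also covers \<open>e' = e\<close>: its two terms cancel, in
    agreement with the zero diagonal of a chain.\<close>
  have lift: "star_lift c (e, e') = of_bool (e' = hub v) * ?y e - of_bool (e = hub v) * ?y e'"
    if "e' \<in> star v" for e'
  proof (cases "e' = e")
    case False
    have "w = v" if "w \<in> e \<inter> e'" for w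
      using edges_common_vertex [of e w v e'] e \<open>e' \<in> star v\<close> False that
      by (simp add: mem_star_iff)
    then have "e \<inter> e' = {v}"
      using e that by (auto simp: mem_star_iff)
    moreover have "(e, e') \<in> parcs (line_graph G)"
      using e that False by (auto simp: line_arc_iff)
    ultimately show ?thesis
      by (simp add: star_lift_def)
  qed (simp add: star_lift_def line_arc_iff)
  have "(\<Sum>e'\<in>star v. of_bool (e' = hub v) * ?y e) = (\<Sum>e'\<in>star v. if e' = hub v then ?y e else 0)"
    by (intro sum.cong) auto
  then have "sd_map (star_lift c) (Inr e, Inl v) = ?y e - of_bool (e = hub v) * (\<Sum>e'\<in>star v. ?y e')"
    using e hub by (simp add: sd_map_apply lift sum_subtractf finite_star flip: sum_distrib_left)
  also have "\<dots> = ?y e"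
    using bd [OF v] by (simp add: boundary_sd_Inl)
  finally show "sd_map (star_lift c) (Inr e, Inl v) = c (Inr e, Inl v)" .
qed

subsection \<open>The kernel\<close>

lemma pverts_sd: "pverts (sd_graph G) = Inl ` V \<union> Inr ` E"
  by (simp add: sd_graph_def)

text \<open>This is what makes the map on critical groups well defined.\<close>

lemma sd_map_crit_lattice:
  assumes "c \<in> crit_lattice (line_graph G)"
  shows "sd_map c \<in> crit_lattice (sd_graph G)"
proof -
  have c: "c \<in> edge_chains (line_graph G)"
    using assms crit_lattice_iff [OF sym_line] by blast
  obtain p where p: "\<And>e. e \<in> E \<Longrightarrow>
      boundary (line_graph G) c e = boundary (line_graph G) (coboundary (line_graph G) p) e"
    using assms crit_lattice_iff [OF sym_line] unfolding pverts_line by blast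
  \<comment> \<open>Scaling by \<open>d\<close> at the midpoints makes the means over stars
    integral: they are the star sums of \<open>p\<close>. The boundary then vanishes at original
    vertices, and at midpoints it is the Laplacian of the line graph.\<close>
  define b where "b = case_sum (\<lambda>v. \<Sum>e\<in>star v. p e) (\<lambda>e. int d * p e)"
  have "boundary (sd_graph G) (sd_map c) x = boundary (sd_graph G) (coboundary (sd_graph G) b) x"
    if "x \<in> pverts (sd_graph G)" for x
  proof (cases x)
    case (Inl v)
    then have "v \<in> V" using that by (auto simp: sd_graph_def)
    then show ?thesis
      using Inl boundary_sd_map_Inl [OF c]
      by (simp add: boundary_sd_Inl coboundary_def sd_arc_iff b_def sum_subtractf card_star
          flip: sum_distrib_left)
  next
    case (Inr e)
    then have e: "e \<in> E" using that by (auto simp: sd_graph_def)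
    have "boundary (sd_graph G) (sd_map c) x = (\<Sum>v\<in>e. \<Sum>e'\<in>star v. p e - p e')"
      using Inr e c p by (simp add: boundary_sd_map_Inr boundary_line_coboundary)
    also have "\<dots> = (\<Sum>v\<in>e. int d * p e - (\<Sum>e'\<in>star v. p e'))"
      using edge_subset [OF e] by (intro sum.cong refl) (auto simp: sum_subtractf card_star)
    also have "\<dots> = boundary (sd_graph G) (coboundary (sd_graph G) b) x"
      using Inr e by (simp add: boundary_sd_Inr coboundary_def sd_arc_iff mem_star_iff b_def)
    finally show ?thesis .
  qed
  then show ?thesis
    unfolding crit_lattice_iff [OF sym_sd] using sd_map_edge_chains by blast
qed

text \<open>The class of a chain \<open>c\<close> of \<open>line G\<close> dies in the critical group of \<open>sd G\<close> iff
  \<open>sd_map c\<close> is a coboundary up to a cycle. Its potential is a function \<open>b\<close> on the midpoints all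
  of whose star sums are divisible by \<open>d\<close>, extended to the original vertices by averaging.\<close>

definition balanced :: "('a set \<Rightarrow> int) set" where
  "balanced = {b. \<forall>v\<in>V. int d dvd (\<Sum>e\<in>star v. b e)}"

definition balanced_group :: "('a set \<Rightarrow> int) monoid" where
  "balanced_group = \<lparr>carrier = balanced, monoid.mult = (+), one = 0\<rparr>"

text \<open>The division is exact for members of \<open>balanced\<close>.\<close>

definition star_mean :: "('a set \<Rightarrow> int) \<Rightarrow> 'a \<Rightarrow> int" where
  "star_mean b v = (\<Sum>e\<in>star v. b e) div int d"

definition bond_of :: "('a set \<Rightarrow> int) \<Rightarrow> ('a + 'a set) \<times> ('a + 'a set) \<Rightarrow> int" where
  "bond_of b = coboundary (sd_graph G) (case_sum (star_mean b) b)"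

text \<open>For balanced \<open>b\<close> the bond has no boundary at original vertices, so it lifts
  to the line graph. The lift is mapped back to a bond, hence its class lies in the kernel.\<close>

definition kernel_class :: "('a set \<Rightarrow> int) \<Rightarrow> ('a set \<times> 'a set \<Rightarrow> int) set" where
  "kernel_class b = crit_class (line_graph G) (star_lift (bond_of b))"

lemma carrier_balanced_group [simp]: "carrier balanced_group = balanced"
  and mult_balanced_group [simp]: "x \<otimes>\<^bsub>balanced_group\<^esub> y = x + y"
  and one_balanced_group [simp]: "\<one>\<^bsub>balanced_group\<^esub> = 0"
  by (simp_all add: balanced_group_def)

lemma group_balanced_group: "group balanced_group"
proof (rule groupI)
  fix x assume "x \<in> carrier balanced_group"
  then show "\<exists>y\<in>carrier balanced_group. y \<otimes>\<^bsub>balanced_group\<^esub> x = \<one>\<^bsub>balanced_group\<^esub>"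
    by (intro bexI [of _ "- x"]) (auto simp: balanced_def sum_negf)
qed (auto simp: balanced_def sum.distrib add_ac)

lemma star_mean:
  assumes "b \<in> balanced" "v \<in> V"
  shows "int d * star_mean b v = (\<Sum>e\<in>star v. b e)"
  using assms by (simp add: balanced_def star_mean_def)

lemma star_mean_eqI:
  assumes "v \<in> V" "(\<Sum>e\<in>star v. b e) = int d * a"
  shows "star_mean b v = a"
  using assms degree_ge_3 by (simp add: star_mean_def)

section \<open>Bonds of balanced functions and their lifts\<close>

lemma bond_of_edge_chains: "bond_of b \<in> edge_chains (sd_graph G)"
  unfolding bond_of_def by (rule coboundary_edge_chains [OF sym_sd])

lemma bond_of_apply: "e \<in> star v \<Longrightarrow> bond_of b (Inr e, Inl v) = star_mean b v - b e"
  and bond_of_apply': "e \<in> star v \<Longrightarrow> bond_of b (Inl v, Inr e) = b e - star_mean b v"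
  by (simp_all add: bond_of_def coboundary_def sd_arc_iff)

lemma bond_of_add:
  assumes "b \<in> balanced" "b' \<in> balanced"
  shows "bond_of (b + b') = bond_of b + bond_of b'"
proof (intro sd_chain_eqI add_edge_chains bond_of_edge_chains)
  fix e v assume e: "e \<in> star v"
  then have "v \<in> V" using edge_subset by (auto simp: mem_star_iff)
  then have "star_mean (b + b') v = star_mean b v + star_mean b' v"
    using assms by (intro star_mean_eqI) (auto simp: sum.distrib distrib_left star_mean)
  then show "bond_of (b + b') (Inr e, Inl v) = (bond_of b + bond_of b') (Inr e, Inl v)"
    using e by (simp add: bond_of_apply)
qed

lemma star_lift_add: "star_lift (c + c') = star_lift c + star_lift c'"
  by (rule ext) (auto simp: star_lift_def algebra_simps sum.distrib sum_subtractf)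

lemma boundary_bond_Inl:
  assumes "b \<in> balanced" "v \<in> V"
  shows "boundary (sd_graph G) (bond_of b) (Inl v) = 0"
  using assms by (simp add: boundary_sd_Inl bond_of_apply sum_subtractf star_mean card_star)

lemma boundary_bond_Inr:
  assumes "e \<in> E"
  shows "boundary (sd_graph G) (bond_of b) (Inr e) = (\<Sum>v\<in>e. b e - star_mean b v)"
  using assms by (simp add: boundary_sd_Inr bond_of_apply' mem_star_iff)

lemma sd_map_lift_bond: "b \<in> balanced \<Longrightarrow> sd_map (star_lift (bond_of b)) = bond_of b"
  by (simp add: sd_map_star_lift bond_of_edge_chains boundary_bond_Inl)

lemma boundary_lift_bond:
  assumes "b \<in> balanced" "e \<in> E"
  shows "boundary (line_graph G) (star_lift (bond_of b)) e = (\<Sum>v\<in>e. b e - star_mean b v)"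
  using assms boundary_sd_map_Inr [OF star_lift_edge_chains, of e "bond_of b"]
  by (simp add: sd_map_lift_bond boundary_bond_Inr)

lemma kernel_class_hom: "kernel_class \<in> hom balanced_group (critical_group (line_graph G))"
proof (rule homI)
  show "kernel_class b \<in> carrier (critical_group (line_graph G))" for b
    by (simp add: kernel_class_def carrier_critical_group star_lift_edge_chains)
  show "kernel_class (b \<otimes>\<^bsub>balanced_group\<^esub> b') =
      kernel_class b \<otimes>\<^bsub>critical_group (line_graph G)\<^esub> kernel_class b'"
    if "b \<in> carrier balanced_group" "b' \<in> carrier balanced_group" for b b'
    using that by (simp add: kernel_class_def bond_of_add star_lift_add
        crit_class_add [OF sym_line] star_lift_edge_chains)
qed

text \<open>Since \<open>sd_map c\<close> has no boundary at original vertices, a potential for it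
  must take the star mean of its midpoint values there. Only a balanced function on the edges
  remains as data.\<close>

lemma sd_map_in_crit_lattice_iff:
  assumes c: "c \<in> edge_chains (line_graph G)"
  shows "sd_map c \<in> crit_lattice (sd_graph G) \<longleftrightarrow>
    (\<exists>b\<in>balanced. crit_class (line_graph G) c = kernel_class b)"
proof
  assume "sd_map c \<in> crit_lattice (sd_graph G)"
  then obtain p where p: "\<And>x. x \<in> pverts (sd_graph G) \<Longrightarrow>
      boundary (sd_graph G) (sd_map c) x = boundary (sd_graph G) (coboundary (sd_graph G) p) x"
    using crit_lattice_iff [OF sym_sd] by blast
  define b where "b = (\<lambda>e. p (Inr e))"
  have sum_b: "(\<Sum>e\<in>star v. b e) = int d * p (Inl v)" if "v \<in> V" for v
  proof -
    have "0 = boundary (sd_graph G) (coboundary (sd_graph G) p) (Inl v)"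
      using p [of "Inl v"] that by (simp add: pverts_sd boundary_sd_map_Inl [OF c])
    also have "\<dots> = (\<Sum>e\<in>star v. p (Inl v) - b e)"
      by (simp add: boundary_sd_Inl coboundary_def sd_arc_iff b_def)
    finally have "0 = (\<Sum>e\<in>star v. p (Inl v) - b e)" .
    then show ?thesis
      using that by (simp add: sum_subtractf card_star)
  qed
  then have b: "b \<in> balanced"
    by (simp add: balanced_def)
  have "boundary (line_graph G) c e = boundary (line_graph G) (star_lift (bond_of b)) e" if "e \<in> E" for e
  proof -
    have "boundary (line_graph G) c e = boundary (sd_graph G) (sd_map c) (Inr e)"
      using that by (simp add: boundary_sd_map_Inr [OF c])
    also have "\<dots> = boundary (sd_graph G) (coboundary (sd_graph G) p) (Inr e)"
      using p that by (simp add: pverts_sd)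
    also have "\<dots> = (\<Sum>v\<in>e. b e - p (Inl v))"
      using that by (simp add: boundary_sd_Inr coboundary_def sd_arc_iff mem_star_iff b_def)
    also have "\<dots> = (\<Sum>v\<in>e. b e - star_mean b v)"
      using edge_subset [OF that] star_mean_eqI [OF _ sum_b] by (intro sum.cong refl) auto
    finally show ?thesis
      using b that by (simp add: boundary_lift_bond)
  qed
  \<comment> \<open>Both chains have the same boundary in the line graph, so they differ by a
    cycle.\<close>
  then have "c - star_lift (bond_of b) \<in> crit_lattice (line_graph G)"
    by (intro cycle_in_crit_lattice sym_line diff_edge_chains c star_lift_edge_chains)
      (simp add: boundary_diff pverts_line)
  then have "crit_class (line_graph G) c = kernel_class b"
    using c by (simp add: kernel_class_def crit_class_eq_iff sym_line star_lift_edge_chains)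
  then show "\<exists>b\<in>balanced. crit_class (line_graph G) c = kernel_class b"
    using b by blast
next
  assume "\<exists>b\<in>balanced. crit_class (line_graph G) c = kernel_class b"
  then obtain b where b: "b \<in> balanced" and "crit_class (line_graph G) c = kernel_class b"
    by blast
  then have "c - star_lift (bond_of b) \<in> crit_lattice (line_graph G)"
    using c by (simp add: kernel_class_def crit_class_eq_iff sym_line star_lift_edge_chains)
  then have "sd_map c - bond_of b \<in> crit_lattice (sd_graph G)"
    using sd_map_crit_lattice sd_map_diff sd_map_lift_bond [OF b] by metis
  then have "(sd_map c - bond_of b) + bond_of b \<in> crit_lattice (sd_graph G)"
    using add_crit_lattice [OF sym_sd _ coboundary_in_crit_lattice [OF sym_sd]]
    unfolding bond_of_def by blast
  then show "sd_map c \<in> crit_lattice (sd_graph G)"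
    by simp
qed

text \<open>The energy \<open>\<Sum>(b e - a v)\<^sup>2\<close> over the flags vanishes: \<open>b e\<close> is the mean of \<open>a\<close> over its ends
  and \<open>a v\<close> is the mean of \<open>b\<close> over its star.\<close>

lemma harmonic_const:
  fixes a :: "'a \<Rightarrow> int" and b :: "'a set \<Rightarrow> int"
  assumes a: "\<And>v. v \<in> V \<Longrightarrow> int d * a v = (\<Sum>e\<in>star v. b e)"
    and b: "\<And>e. e \<in> E \<Longrightarrow> (\<Sum>v\<in>e. b e - a v) = 0"
  obtains k where "\<And>e. e \<in> E \<Longrightarrow> b e = k"
proof -
  \<comment> \<open>The square splits into two products. The first vanishes edge by edge by
    \<open>b\<close>; the second, regrouped by vertices, vanishes by \<open>a\<close>.\<close>
  have "(\<Sum>e\<in>E. \<Sum>v\<in>e. (b e - a v)\<^sup>2) = (\<Sum>e\<in>E. \<Sum>v\<in>e. b e * (b e - a v) - a v * (b e - a v))"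
    by (simp add: power2_eq_square algebra_simps)
  also have "\<dots> = (\<Sum>e\<in>E. b e * (\<Sum>v\<in>e. b e - a v)) - (\<Sum>e\<in>E. \<Sum>v\<in>e. a v * (b e - a v))"
    by (simp only: sum_distrib_left flip: sum_subtractf)
  also have "(\<Sum>e\<in>E. b e * (\<Sum>v\<in>e. b e - a v)) = 0"
    using b by simp
  also have "(\<Sum>e\<in>E. \<Sum>v\<in>e. a v * (b e - a v)) = (\<Sum>v\<in>V. a v * (\<Sum>e\<in>star v. b e - a v))"
    by (simp add: sum_star_eq_sum_edge [symmetric] sum_distrib_left)
  also have "\<dots> = 0"
    using a by (intro sum.neutral ballI) (simp add: sum_subtractf card_star)
  finally have "(\<Sum>e\<in>E. \<Sum>v\<in>e. (b e - a v)\<^sup>2) = 0"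
    by simp
  then have eq: "b e = a v" if "e \<in> E" "v \<in> e" for e v
    using that finite_E finite_edge by (simp add: sum_nonneg_eq_0_iff sum_nonneg)
  obtain r where r: "r \<in> V" using V_nonempty by blast
  have "a v = a r" if "v \<in> V" for v
    using r that refl
  proof (rule connected_induct)
    fix u w assume "a u = a r" "(u, w) \<in> parcs G"
    then show "a w = a r"
      using eq [of "{u, w}" u] eq [of "{u, w}" w] by (simp add: edge_iff_arc)
  qed
  then have "b e = a r" if "e \<in> E" for e
    using that by (metis edgeE eq insertI1)
  then show thesis by (rule that)
qed

text \<open>The class is trivial iff the boundary of the lift is the Laplacian of some
  \<open>p\<close> on the line graph. Then \<open>b - d * p\<close> is harmonic, hence constant;
  conversely, writing \<open>b\<close> as \<open>k + d * p\<close> exhibits such a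
  \<open>p\<close>.\<close>

lemma kernel_class_eq_one_iff:
  assumes b: "b \<in> balanced"
  shows "kernel_class b = \<one>\<^bsub>critical_group (line_graph G)\<^esub> \<longleftrightarrow> (\<exists>k. \<forall>e\<in>E. int d dvd b e - k)"
proof -
  have mean: "(\<Sum>v\<in>e. \<Sum>e'\<in>star v. p e - p e') = (\<Sum>v\<in>e. int d * p e - (\<Sum>e'\<in>star v. p e'))"
    if "e \<in> E" for e and p :: "'a set \<Rightarrow> int"
    using edge_subset [OF that] by (intro sum.cong refl) (auto simp: sum_subtractf card_star)
  have "kernel_class b = \<one>\<^bsub>critical_group (line_graph G)\<^esub> \<longleftrightarrow>
      star_lift (bond_of b) \<in> crit_lattice (line_graph G)"
    by (simp add: kernel_class_def crit_class_eq_one_iff sym_line star_lift_edge_chains)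
  also have "\<dots> \<longleftrightarrow> (\<exists>p. \<forall>e\<in>E. (\<Sum>v\<in>e. b e - star_mean b v) =
      (\<Sum>v\<in>e. int d * p e - (\<Sum>e'\<in>star v. p e')))"
    unfolding crit_lattice_iff [OF sym_line] pverts_line
    using star_lift_edge_chains b
    by (simp add: boundary_lift_bond boundary_line_coboundary mean)
  also have "\<dots> \<longleftrightarrow> (\<exists>k. \<forall>e\<in>E. int d dvd b e - k)"
  proof
    assume "\<exists>p. \<forall>e\<in>E. (\<Sum>v\<in>e. b e - star_mean b v) = (\<Sum>v\<in>e. int d * p e - (\<Sum>e'\<in>star v. p e'))"
    then obtain p where p: "\<And>e. e \<in> E \<Longrightarrow>
        (\<Sum>v\<in>e. b e - star_mean b v) = (\<Sum>v\<in>e. int d * p e - (\<Sum>e'\<in>star v. p e'))"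
      by blast
    \<comment> \<open>Subtracting \<open>d * p\<close> from \<open>b\<close>, and the star sums of
      \<open>p\<close> from the means, turns the equation for \<open>p\<close> into the hypotheses
      of \<open>harmonic_const\<close>.\<close>
    obtain k where "\<And>e. e \<in> E \<Longrightarrow> b e - int d * p e = k"
    proof (rule harmonic_const)
      show "int d * (star_mean b v - (\<Sum>e\<in>star v. p e)) = (\<Sum>e\<in>star v. b e - int d * p e)"
        if "v \<in> V" for v
        using that b by (simp add: right_diff_distrib star_mean sum_subtractf sum_distrib_left)
      show "(\<Sum>v\<in>e. b e - int d * p e - (star_mean b v - (\<Sum>e\<in>star v. p e))) = 0"
        if "e \<in> E" for e
      proof -
        have "(\<Sum>v\<in>e. b e - int d * p e - (star_mean b v - (\<Sum>e\<in>star v. p e))) =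
            (\<Sum>v\<in>e. b e - star_mean b v) - (\<Sum>v\<in>e. int d * p e - (\<Sum>e'\<in>star v. p e'))"
          unfolding sum_subtractf [symmetric] by (intro sum.cong refl) simp
        then show ?thesis using p [OF that] by simp
      qed
    qed (rule that)
    then have "\<forall>e\<in>E. b e - k = int d * p e"
      by force
    then have "\<forall>e\<in>E. int d dvd b e - k"
      by simp
    then show "\<exists>k. \<forall>e\<in>E. int d dvd b e - k" ..
  next
    assume "\<exists>k. \<forall>e\<in>E. int d dvd b e - k"
    then obtain k where k: "\<And>e. e \<in> E \<Longrightarrow> int d dvd b e - k" by blast
    define p where "p = (\<lambda>e. (b e - k) div int d)"
    have p: "b e = k + int d * p e" if "e \<in> E" for e
      using k [OF that] by (simp add: p_def)
    have "star_mean b v = k + (\<Sum>e\<in>star v. p e)" if "v \<in> V" for v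
    proof (rule star_mean_eqI [OF that])
      have "(\<Sum>e\<in>star v. b e) = (\<Sum>e\<in>star v. k + int d * p e)"
        by (intro sum.cong refl p) (simp add: mem_star_iff)
      then show "(\<Sum>e\<in>star v. b e) = int d * (k + (\<Sum>e\<in>star v. p e))"
        using that by (simp add: sum.distrib card_star distrib_left sum_distrib_left)
    qed
    then have "(\<Sum>v\<in>e. b e - star_mean b v) = (\<Sum>v\<in>e. int d * p e - (\<Sum>e'\<in>star v. p e'))"
      if "e \<in> E" for e
      using edge_subset [OF that] p [OF that] by (intro sum.cong refl) auto
    then show "\<exists>p. \<forall>e\<in>E. (\<Sum>v\<in>e. b e - star_mean b v) = (\<Sum>v\<in>e. int d * p e - (\<Sum>e'\<in>star v. p e'))"
      by blast
  qed
  finally show ?thesis .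
qed

text \<open>\<open>sd_map\<close> respects the lattices and so factors through the quotients. The
  kernel is \<open>sd_map_in_crit_lattice_iff\<close> read on classes.\<close>

lemma induced_hom:
  obtains f where "f \<in> hom (critical_group (line_graph G)) (critical_group (sd_graph G))"
    and "\<And>c. c \<in> edge_chains (line_graph G) \<Longrightarrow>
      f (crit_class (line_graph G) c) = crit_class (sd_graph G) (sd_map c)"
    and "kernel (critical_group (line_graph G)) (critical_group (sd_graph G)) f = kernel_class ` balanced"
proof -
  let ?h = "\<lambda>c. crit_class (sd_graph G) (sd_map c)"
  have "?h \<in> hom (chain_group (line_graph G)) (critical_group (sd_graph G))"
    using hom_compose [OF sd_map_hom crit_class_hom [OF sym_sd]] by (simp add: comp_def)
  then interpret h: group_hom "chain_group (line_graph G)" "critical_group (sd_graph G)" ?h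
    by (simp add: group_hom_def group_hom_axioms_def group_chain_group group_critical_group sym_sd)
  have "crit_lattice (line_graph G) \<subseteq> kernel (chain_group (line_graph G)) (critical_group (sd_graph G)) ?h"
    using sd_map_crit_lattice crit_lattice_iff [OF sym_line]
    by (auto simp: kernel_def crit_class_eq_one_iff sym_sd sd_map_edge_chains)
  then obtain f where hom: "f \<in> hom (critical_group (line_graph G)) (critical_group (sd_graph G))"
    and f: "\<And>c. c \<in> edge_chains (line_graph G) \<Longrightarrow> f (crit_class (line_graph G) c) = ?h c"
    using h.FactGroup_universal_kernel [OF crit_lattice_normal [OF sym_line]]
    unfolding critical_group_def crit_class_def carrier_chain_group by blast
  have ker: "f (crit_class (line_graph G) c) = \<one>\<^bsub>critical_group (sd_graph G)\<^esub> \<longleftrightarrow>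
      crit_class (line_graph G) c \<in> kernel_class ` balanced" if "c \<in> edge_chains (line_graph G)" for c
    using sd_map_in_crit_lattice_iff [OF that]
    by (simp add: f [OF that] crit_class_eq_one_iff sym_sd sd_map_edge_chains image_iff Bex_def)
  have "kernel_class b \<in> carrier (critical_group (line_graph G))" for b
    by (simp add: kernel_class_def carrier_critical_group star_lift_edge_chains)
  then have sub: "kernel_class ` balanced \<subseteq> carrier (critical_group (line_graph G))"
    by blast
  have "kernel (critical_group (line_graph G)) (critical_group (sd_graph G)) f = kernel_class ` balanced"
  proof (rule Set.set_eqI)
    fix X
    show "X \<in> kernel (critical_group (line_graph G)) (critical_group (sd_graph G)) f
        \<longleftrightarrow> X \<in> kernel_class ` balanced"
    proof (cases "X \<in> carrier (critical_group (line_graph G))")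
      case True
      then obtain c where "c \<in> edge_chains (line_graph G)" "X = crit_class (line_graph G) c"
        unfolding carrier_critical_group by blast
      then show ?thesis
        using ker True by (simp add: kernel_def)
    next
      case False
      then show ?thesis
        using sub unfolding kernel_def by blast
    qed
  qed
  with hom f show thesis by (rule that)
qed

end

section \<open>Rooted spanning trees\<close>

text \<open>The tree is encoded by parent pointers; the depth condition makes iterated parents of
  \<open>v\<close> reach the root after exactly \<open>dep v\<close> steps.\<close>

locale rooted_regular_graph = regular_graph +
  fixes r :: 'a and dep :: "'a \<Rightarrow> nat" and par :: "'a \<Rightarrow> 'a"
  assumes root: "r \<in> V"
    and dep_root: "dep r = 0"
    and par_arc: "v \<in> V \<Longrightarrow> v \<noteq> r \<Longrightarrow> (par v, v) \<in> parcs G"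
    and dep_par: "v \<in> V \<Longrightarrow> v \<noteq> r \<Longrightarrow> dep v = Suc (dep (par v))"

text \<open>A breadth-first tree: \<open>dep\<close> is the distance from \<open>r\<close>, and a
  parent is the last vertex but one on a shortest walk.\<close>

lemma (in regular_graph) rooted_tree_exists:
  obtains r dep par where "rooted_regular_graph G d r dep par"
proof -
  obtain r where r: "r \<in> V" using V_nonempty by blast
  define dep where "dep = (\<lambda>v. LEAST n. (r, v) \<in> parcs G ^^ n)"
  have dep_le: "dep v \<le> n" if "(r, v) \<in> parcs G ^^ n" for v n
    unfolding dep_def using that by (rule Least_le)
  have "\<exists>n. (r, v) \<in> parcs G ^^ n" if "v \<in> V" for v
    using r that
  proof (rule connected_induct)
    show "\<exists>n. (r, r) \<in> parcs G ^^ n"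
      by (rule exI [of _ 0]) simp
    show "\<exists>n. (r, w) \<in> parcs G ^^ n" if "\<exists>n. (r, u) \<in> parcs G ^^ n" "(u, w) \<in> parcs G" for u w
      using that relpow_Suc_I by metis
  qed
  then have dep: "(r, v) \<in> parcs G ^^ dep v" if "v \<in> V" for v
    unfolding dep_def using that by (metis LeastI_ex)
  have "\<exists>u. (u, v) \<in> parcs G \<and> dep v = Suc (dep u)" if v: "v \<in> V" "v \<noteq> r" for v
  proof -
    obtain m where m: "dep v = Suc m"
      using dep [OF v(1)] v(2) by (cases "dep v") auto
    then obtain u where u: "(r, u) \<in> parcs G ^^ m" "(u, v) \<in> parcs G"
      using dep [OF v(1)] by auto
    have "(r, v) \<in> parcs G ^^ Suc (dep u)"
      using dep [OF arc_fst [OF u(2)]] u(2) by auto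
    then have "dep v = Suc (dep u)"
      using dep_le [OF u(1)] dep_le [of v "Suc (dep u)"] m by simp
    then show ?thesis using u(2) by blast
  qed
  then obtain par where "\<And>v. v \<in> V \<Longrightarrow> v \<noteq> r \<Longrightarrow> (par v, v) \<in> parcs G \<and> dep v = Suc (dep (par v))"
    by metis
  moreover have "dep r = 0"
    using dep_le [of r 0] by simp
  ultimately have "rooted_regular_graph G d r dep par"
    using r by unfold_locales auto
  then show thesis by (rule that)
qed

section \<open>Signs, alternating paths and the incidence system\<close>

context rooted_regular_graph
begin

text \<open>The signs 2-colour the tree properly. An edge has sign sum 0 if its ends differ in
  colour, and 2 or -2 if it closes an odd cycle with the tree.\<close>

definition sg :: "'a \<Rightarrow> int" where
  "sg v = (if even (dep v) then 1 else -1)"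

definition tree :: "'a set set" where
  "tree = (\<lambda>v. {v, par v}) ` (V - {r})"

definition cotree :: "'a set set" where
  "cotree = E - tree"

text \<open>The signs alternate because the incidence matrix is unsigned: all star sums of \<open>path v\<close>
  cancel except at \<open>v\<close> and at the root.\<close>

definition path :: "'a \<Rightarrow> 'a set \<Rightarrow> int" where
  "path v e = (\<Sum>i<dep v. (-1) ^ i * of_bool (e = {(par ^^ i) v, (par ^^ Suc i) v}))"

lemma par_V: "v \<in> V \<Longrightarrow> v \<noteq> r \<Longrightarrow> par v \<in> V"
  by (rule arc_fst [OF par_arc])

lemma par_neq: "v \<in> V \<Longrightarrow> v \<noteq> r \<Longrightarrow> v \<noteq> par v"
  by (rule arc_neq [OF par_arc, symmetric])

lemma tree_edge: "v \<in> V \<Longrightarrow> v \<noteq> r \<Longrightarrow> {v, par v} \<in> tree"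
  by (auto simp: tree_def)

lemma tree_edge_in_E: "v \<in> V \<Longrightarrow> v \<noteq> r \<Longrightarrow> {v, par v} \<in> E"
  unfolding edge_iff_arc by (rule arc_sym [THEN iffD1, OF par_arc])

lemma treeE:
  assumes "e \<in> tree"
  obtains v where "e = {v, par v}" "v \<in> V" "v \<noteq> r" "v \<noteq> par v" "par v \<in> V"
proof -
  obtain v where v: "e = {v, par v}" "v \<in> V" "v \<noteq> r"
    using assms by (auto simp: tree_def)
  show thesis
    by (rule that [OF v par_neq [OF v(2,3)] par_V [OF v(2,3)]])
qed

lemma tree_subset: "tree \<subseteq> E"
  using tree_edge_in_E by (auto simp: tree_def)

lemma tree_induct [consumes 1, case_names root step]:
  assumes "v \<in> V" "Q r" "\<And>v. v \<in> V \<Longrightarrow> v \<noteq> r \<Longrightarrow> Q (par v) \<Longrightarrow> Q v"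
  shows "Q v"
  using assms(1)
proof (induction "dep v" arbitrary: v)
  case 0
  then have "v = r" using dep_par by fastforce
  then show ?case using assms(2) by simp
next
  case (Suc n)
  then have "v \<noteq> r" using dep_root by auto
  then have "Q (par v)"
    using Suc dep_par par_V by simp
  then show ?case
    using assms(3) Suc.prems \<open>v \<noteq> r\<close> by blast
qed

lemma path_root: "path r e = 0"
  by (simp add: path_def dep_root)

lemma path_step:
  assumes "v \<in> V" "v \<noteq> r"
  shows "path v e = of_bool (e = {v, par v}) - path (par v) e"
proof -
  have "path v e = of_bool (e = {v, par v}) +
      (\<Sum>i<dep (par v). - ((-1) ^ i * of_bool (e = {(par ^^ i) (par v), (par ^^ Suc i) (par v)})))"
    unfolding path_def dep_par [OF assms] sum.lessThan_Suc_shift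
    by (simp add: funpow_swap1)
  then show ?thesis
    by (simp add: path_def sum_negf)
qed

lemma sg_root: "sg r = 1"
  and sg_step: "v \<in> V \<Longrightarrow> v \<noteq> r \<Longrightarrow> sg v = - sg (par v)"
  by (simp_all add: sg_def dep_root dep_par)

lemma path_cotree:
  assumes "v \<in> V" "e \<notin> tree"
  shows "path v e = 0"
  using assms(1)
proof (induction rule: tree_induct)
  case (step v)
  then have "e \<noteq> {v, par v}"
    using assms(2) tree_edge by blast
  then show ?case using step by (simp add: path_step)
qed (rule path_root)

lemma sum_star_indicator:
  assumes "{u, v} \<in> E" "u \<noteq> v"
  shows "(\<Sum>e\<in>star w. of_bool (e = {u, v})) = (of_bool (w = u) + of_bool (w = v) :: int)"
proof -
  have "(\<Sum>e\<in>star w. of_bool (e = {u, v}) :: int) = (\<Sum>e\<in>star w. if e = {u, v} then 1 else 0)"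
    by (intro sum.cong) auto
  also have "\<dots> = of_bool ({u, v} \<in> star w)"
    by (simp add: finite_star)
  also have "\<dots> = of_bool (w = u) + of_bool (w = v)"
    using assms by (auto simp: mem_star_iff)
  finally show ?thesis .
qed

text \<open>Passing from \<open>par v\<close> to \<open>v\<close> adds one edge and negates the
  rest, so the new contribution at \<open>par v\<close> cancels the old one.\<close>

lemma sum_star_path:
  assumes "v \<in> V"
  shows "(\<Sum>e\<in>star w. path v e) = of_bool (w = v) - sg v * of_bool (w = r)"
  using assms
proof (induction rule: tree_induct)
  case root
  then show ?case by (simp add: path_root sg_root)
next
  case (step v)
  have "(\<Sum>e\<in>star w. path v e) = (\<Sum>e\<in>star w. of_bool (e = {v, par v})) - (\<Sum>e\<in>star w. path (par v) e)"
    using step by (simp add: path_step sum_subtractf)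
  also have "(\<Sum>e\<in>star w. of_bool (e = {v, par v})) = (of_bool (w = v) + of_bool (w = par v) :: int)"
    using step by (intro sum_star_indicator tree_edge_in_E par_neq)
  finally show ?case
    using step sg_step by simp
qed

text \<open>Paths invert the taking of star sums, up to a defect collected at the root: the signed
  total of \<open>h\<close>.\<close>

lemma sum_star_paths:
  assumes "w \<in> V"
  shows "(\<Sum>e\<in>star w. \<Sum>v\<in>V. h v * path v e) = h w - of_bool (w = r) * (\<Sum>v\<in>V. sg v * h v)"
proof -
  have "(\<Sum>e\<in>star w. \<Sum>v\<in>V. h v * path v e) = (\<Sum>v\<in>V. h v * (\<Sum>e\<in>star w. path v e))"
    by (simp add: sum_distrib_left sum.swap [of _ V])
  also have "\<dots> = (\<Sum>v\<in>V. (if w = v then h v else 0) - of_bool (w = r) * (sg v * h v))"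
    by (intro sum.cong refl) (simp add: sum_star_path algebra_simps)
  also have "\<dots> = h w - of_bool (w = r) * (\<Sum>v\<in>V. sg v * h v)"
    using assms finite_V by (simp add: sum_subtractf sum_distrib_left)
  finally show ?thesis .
qed

text \<open>By the alternating signs, the paths of \<open>v\<close> and \<open>par v\<close> add up
  to the one edge between them.\<close>

lemma path_edge_sum:
  assumes "e \<in> tree"
  shows "(\<Sum>v\<in>e. path v f) = of_bool (f = e)"
  using assms by (elim treeE) (simp add: path_step)

lemma sg_edge_sum:
  assumes "e \<in> tree"
  shows "(\<Sum>v\<in>e. sg v) = 0"
  using assms by (elim treeE) (simp add: sg_step)

text \<open>The sign \<open>s\<close> is 1 or -1, recorded as \<open>s * s = 1\<close> because it
  serves as its own inverse later.\<close>

lemma sg_edge_sum_cases: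
  assumes "e \<in> E"
  obtains "(\<Sum>v\<in>e. sg v) = 0" | s where "s * s = 1" "(\<Sum>v\<in>e. sg v) = 2 * s"
  using assms that by (elim edgeE) (force simp: sg_def split: if_splits)

text \<open>Regrouped by edges, the sum weighs each edge by the sign sum of its ends, which is zero
  on the tree.\<close>

lemma sum_sg_star_sums:
  "(\<Sum>v\<in>V. sg v * (\<Sum>e\<in>star v. b e)) = (\<Sum>e\<in>cotree. (\<Sum>v\<in>e. sg v) * b e)"
proof -
  have "(\<Sum>v\<in>V. sg v * (\<Sum>e\<in>star v. b e)) = (\<Sum>e\<in>E. (\<Sum>v\<in>e. sg v) * b e)"
    by (simp add: sum_distrib_left sum_distrib_right sum_star_eq_sum_edge)
  also have "\<dots> = (\<Sum>e\<in>cotree. (\<Sum>v\<in>e. sg v) * b e)"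
    unfolding cotree_def
    by (intro sum.mono_neutral_right) (auto simp: finite_E sg_edge_sum)
  finally show ?thesis .
qed

text \<open>Pairing the star sums with \<open>path v f\<close> and regrouping by edges leaves, among
  the tree edges, only \<open>b f\<close>.\<close>

lemma tree_values:
  assumes "f \<in> tree"
  shows "b f = (\<Sum>v\<in>V. (\<Sum>e\<in>star v. b e) * path v f) - (\<Sum>e\<in>cotree. b e * (\<Sum>v\<in>e. path v f))"
proof -
  have "(\<Sum>v\<in>V. (\<Sum>e\<in>star v. b e) * path v f) = (\<Sum>e\<in>E. b e * (\<Sum>v\<in>e. path v f))"
    by (simp add: sum_distrib_left sum_distrib_right sum_star_eq_sum_edge)
  also have "\<dots> = (\<Sum>e\<in>cotree. b e * (\<Sum>v\<in>e. path v f)) + (\<Sum>e\<in>tree. b e * (\<Sum>v\<in>e. path v f))"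
    unfolding cotree_def by (rule sum.subset_diff [OF tree_subset finite_E])
  also have "(\<Sum>e\<in>tree. b e * (\<Sum>v\<in>e. path v f)) = (\<Sum>e\<in>tree. if f = e then b e else 0)"
    by (intro sum.cong refl) (simp add: path_edge_sum)
  also have "\<dots> = b f"
    using assms finite_subset [OF tree_subset finite_E] by simp
  finally show ?thesis by simp
qed

text \<open>By \<open>tree_values\<close>, each tree value is an integer combination of star sums
  and cotree values.\<close>

lemma dvd_all_edges:
  assumes "\<And>v. v \<in> V \<Longrightarrow> m dvd (\<Sum>e\<in>star v. b e)" "\<And>e. e \<in> cotree \<Longrightarrow> m dvd b e" "f \<in> E"
  shows "m dvd (b f :: int)"
proof (cases "f \<in> tree")
  case True
  have "m dvd (\<Sum>v\<in>V. (\<Sum>e\<in>star v. b e) * path v f)"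
    by (rule dvd_sum) (rule dvd_mult2 [OF assms(1)])
  moreover have "m dvd (\<Sum>e\<in>cotree. b e * (\<Sum>v\<in>e. path v f))"
    by (rule dvd_sum) (rule dvd_mult2 [OF assms(2)])
  ultimately show ?thesis
    unfolding tree_values [OF True, of b] by (rule dvd_diff)
next
  case False
  then show ?thesis using assms by (simp add: cotree_def)
qed

text \<open>Subtracting paths weighted by the star sums of \<open>y\<close> changes tree edges only
  and moves all star sums to the root, where they arrive with their signs.\<close>

lemma extend_from_cotree:
  obtains b where "\<And>e. e \<in> cotree \<Longrightarrow> b e = y e"
    and "\<And>w. w \<in> V \<Longrightarrow> (\<Sum>e\<in>star w. b e) = of_bool (w = r) * (\<Sum>e\<in>cotree. (\<Sum>v\<in>e. sg v) * y e)"
proof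
  let ?b = "\<lambda>f. y f - (\<Sum>v\<in>V. (\<Sum>e\<in>star v. y e) * path v f)"
  show "?b e = y e" if "e \<in> cotree" for e
    using that by (simp add: path_cotree cotree_def)
  show "(\<Sum>e\<in>star w. ?b e) = of_bool (w = r) * (\<Sum>e\<in>cotree. (\<Sum>v\<in>e. sg v) * y e)" if "w \<in> V" for w
    unfolding sum_subtractf sum_star_paths [OF that] sum_sg_star_sums by simp
qed

text \<open>The side of a bipartition alternates along the tree, so it is determined by the parity
  of the depth. Conversely, the parity classes form a bipartition if all sign sums vanish.\<close>

lemma bipartite_iff: "bipartite G \<longleftrightarrow> (\<forall>e\<in>E. (\<Sum>v\<in>e. sg v) = 0)"
proof
  assume "bipartite G"
  then obtain A B where disj: "A \<inter> B = {}"
    and arcs: "\<forall>(u, v)\<in>parcs G. (u \<in> A \<and> v \<in> B) \<or> (u \<in> B \<and> v \<in> A)"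
    unfolding bipartite_def by (elim exE conjE)
  have swap: "u \<in> A \<longleftrightarrow> v \<notin> A" if "(u, v) \<in> parcs G" for u v
    using disj bspec [OF arcs that] by auto
  have side: "(v \<in> A \<longleftrightarrow> r \<in> A) \<longleftrightarrow> even (dep v)" if "v \<in> V" for v
    using that
  proof (induction rule: tree_induct)
    case (step v)
    then show ?case using swap [OF par_arc [OF step(1,2)]] dep_par by auto
  qed (simp add: dep_root)
  show "\<forall>e\<in>E. (\<Sum>v\<in>e. sg v) = 0"
  proof
    fix e assume "e \<in> E"
    then obtain u v where e: "e = {u, v}" "(u, v) \<in> parcs G" "u \<noteq> v" "u \<in> V" "v \<in> V"
      by (rule edgeE)
    then show "(\<Sum>v\<in>e. sg v) = 0"
      using side [OF e(4)] side [OF e(5)] swap [OF e(2)] by (auto simp: sg_def)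
  qed
next
  assume zero: "\<forall>e\<in>E. (\<Sum>v\<in>e. sg v) = 0"
  have "sg u + sg v = 0" if "(u, v) \<in> parcs G" for u v
    using zero [rule_format, of "{u, v}"] that arc_neq [OF that] by (simp add: edge_iff_arc)
  then have "even (dep u) \<noteq> even (dep v)" if "(u, v) \<in> parcs G" for u v
    using that by (fastforce simp: sg_def split: if_splits)
  then have "(u \<in> {v\<in>V. even (dep v)} \<and> v \<in> {v\<in>V. odd (dep v)}) \<or>
      (u \<in> {v\<in>V. odd (dep v)} \<and> v \<in> {v\<in>V. even (dep v)})" if "(u, v) \<in> parcs G" for u v
    using that arc_fst [OF that] arc_snd [OF that] by auto
  moreover have "{v\<in>V. even (dep v)} \<union> {v\<in>V. odd (dep v)} = V"
    "{v\<in>V. even (dep v)} \<inter> {v\<in>V. odd (dep v)} = {}"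
    by auto
  ultimately show "bipartite G"
    unfolding bipartite_def by blast
qed

lemma finite_cotree: "finite cotree"
  by (simp add: cotree_def finite_E)

text \<open>Counting flags gives \<open>2 * card E = d * card V\<close>, at least three times
  \<open>card V\<close>, while the tree has fewer than \<open>card V\<close> edges. With
  \<open>betti_eq\<close>, this shows that the subtraction in \<open>betti G - 2\<close> does not
  truncate.\<close>

lemma card_cotree: "card cotree \<ge> 2"
proof -
  have "2 * card E = d * card V"
  proof -
    have "(\<Sum>v\<in>V. card (star v)) = (\<Sum>e\<in>E. card e)"
      using sum_star_eq_sum_edge [of "\<lambda>_ _. 1 :: nat"] by simp
    moreover have "(\<Sum>e\<in>E. card e) = (\<Sum>e\<in>E. 2)"
      by (intro sum.cong refl) (auto elim!: edgeE)
    ultimately show ?thesis by (simp add: card_star mult.commute)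
  qed
  moreover have "3 * card V \<le> d * card V"
    using degree_ge_3 by simp
  moreover have "card tree \<le> card V - 1"
    using card_image_le [of "V - {r}" "\<lambda>v. {v, par v}"] finite_V root by (simp add: tree_def)
  moreover have "card V > 0"
    using root finite_V by (auto simp: card_gt_0_iff)
  moreover have "card cotree = card E - card tree"
    unfolding cotree_def using finite_subset [OF tree_subset finite_E] tree_subset
    by (rule card_Diff_subset)
  ultimately show ?thesis by linarith
qed

end

section \<open>The Betti number\<close>

lemma sum_fun_apply: "(\<Sum>x\<in>A. g x) a = (\<Sum>x\<in>A. g x a)"
  by (induction A rule: infinite_finite_induct) auto

context rooted_regular_graph
begin

definition rat_arc :: "'a \<Rightarrow> 'a \<Rightarrow> 'a \<times> 'a \<Rightarrow> rat" where
  "rat_arc u v a = of_int (arc_chain u v a)"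

text \<open>The tree walk from \<open>r\<close> to \<open>v\<close>, with arcs pointing away from
  the root. It is an oriented chain, so its signs do not alternate as those of \<open>path\<close>
  do.\<close>

definition root_path :: "'a \<Rightarrow> 'a \<times> 'a \<Rightarrow> rat" where
  "root_path v a = (\<Sum>i<dep v. rat_arc ((par ^^ Suc i) v) ((par ^^ i) v) a)"

definition fundamental_cycle :: "'a \<Rightarrow> 'a \<Rightarrow> 'a \<times> 'a \<Rightarrow> rat" where
  "fundamental_cycle u v = rat_arc u v + root_path u - root_path v"

lemma sym_G: "sym (parcs G)"
  by (rule symI) (rule arc_sym [THEN iffD1])

lemma rat_arc_apply:
  assumes "u \<noteq> v"
  shows "rat_arc u v (x, y) = of_bool ((x, y) = (u, v)) - of_bool ((x, y) = (v, u))"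
  using assms by (auto simp: rat_arc_def arc_chain_def)

lemma rat_arc_edge_chains:
  assumes "(u, v) \<in> parcs G"
  shows "rat_arc u v \<in> edge_chains G"
proof (rule edge_chainsI)
  have "arc_chain u v \<in> edge_chains G"
    using assms arc_neq [OF assms] by (intro arc_chain_edge_chains sym_G)
  then show "rat_arc u v (y, x) = - rat_arc u v (x, y)" "a \<notin> parcs G \<Longrightarrow> rat_arc u v a = 0" for x y a
    unfolding rat_arc_def by (simp_all add: edge_chains_antisym [of _ _ y x] edge_chains_support)
qed

lemma boundary_rat_arc:
  assumes "(u, v) \<in> parcs G"
  shows "boundary G (rat_arc u v) w = of_bool (w = v) - of_bool (w = u)"
proof -
  have "{x. (x, w) \<in> parcs G} \<subseteq> V"
    using arc_fst by blast
  then have fin: "finite {x. (x, w) \<in> parcs G}"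
    using finite_V finite_subset by blast
  have "boundary G (rat_arc u v) w = (\<Sum>x | (x, w) \<in> parcs G.
      (if x = u then of_bool (w = v) else 0) - (if x = v then of_bool (w = u) else 0))"
    unfolding boundary_def using arc_neq [OF assms]
    by (intro sum.cong refl) (auto simp: rat_arc_apply)
  also have "\<dots> = of_bool (w = v) - of_bool (w = u)"
    using assms arc_sym [of u v] fin by (auto simp: sum_subtractf)
  finally show ?thesis .
qed

lemma root_path_root: "root_path r = 0"
  by (rule ext) (simp add: root_path_def dep_root)

lemma root_path_step:
  assumes "v \<in> V" "v \<noteq> r"
  shows "root_path v = rat_arc (par v) v + root_path (par v)"
  unfolding root_path_def dep_par [OF assms] sum.lessThan_Suc_shift
  by (rule ext) (simp add: funpow_swap1)

lemma root_path_edge_chains: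
  assumes "v \<in> V"
  shows "root_path v \<in> edge_chains G"
  using assms
proof (induction rule: tree_induct)
  case root
  show ?case unfolding root_path_root by (rule zero_edge_chains)
next
  case (step v)
  then show ?case
    unfolding root_path_step [OF step(1,2)]
    by (intro add_edge_chains rat_arc_edge_chains par_arc)
qed

lemma boundary_root_path:
  assumes "v \<in> V"
  shows "boundary G (root_path v) w = of_bool (w = v) - of_bool (w = r)"
  using assms
proof (induction rule: tree_induct)
  case root
  show ?case unfolding root_path_root boundary_zero by simp
next
  case (step v)
  then show ?case
    unfolding root_path_step [OF step(1,2)] boundary_add boundary_rat_arc [OF par_arc [OF step(1,2)]]
    by simp
qed

lemma root_path_cotree:
  assumes "v \<in> V" "{x, y} \<notin> tree"
  shows "root_path v (x, y) = 0"
  using assms(1)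
proof (induction rule: tree_induct)
  case (step v)
  have "{x, y} \<noteq> {v, par v}"
    using step assms(2) tree_edge by metis
  then have "rat_arc (par v) v (x, y) = 0"
    using par_neq [OF step(1,2)] by (auto simp: rat_arc_apply)
  then show ?case using step by (simp add: root_path_step)
qed (simp add: root_path_root)

lemma fundamental_cycle_in_cycles:
  assumes "(u, v) \<in> parcs G"
  shows "fundamental_cycle u v \<in> cycles G"
  using assms arc_fst [OF assms] arc_snd [OF assms]
  by (simp add: cycles_iff fundamental_cycle_def add_edge_chains diff_edge_chains rat_arc_edge_chains
      root_path_edge_chains boundary_add boundary_diff boundary_rat_arc boundary_root_path)

lemma rat_arc_swap: "u \<noteq> v \<Longrightarrow> rat_arc v u = - rat_arc u v"
  by (rule ext) (auto simp: rat_arc_apply)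

lemma fundamental_cycle_swap:
  assumes "u \<noteq> v"
  shows "fundamental_cycle v u = - fundamental_cycle u v"
  unfolding fundamental_cycle_def rat_arc_swap [OF assms] by simp

lemma fundamental_cycle_tree:
  assumes "{u, v} \<in> tree" "u \<noteq> v"
  shows "fundamental_cycle u v = 0"
proof -
  obtain w where w: "{u, v} = {w, par w}" "w \<in> V" "w \<noteq> r"
    using assms(1) by (auto elim: treeE)
  have "fundamental_cycle (par w) w = 0"
    using w by (simp add: fundamental_cycle_def root_path_step)
  then show ?thesis
    using w(1) fundamental_cycle_swap [OF assms(2)] by (auto simp: doubleton_eq_iff)
qed

text \<open>Grouped by heads, the sum pairs \<open>h\<close> with the boundary of
  \<open>c\<close>.\<close>

lemma sum_arcs_snd:
  fixes c :: "'a \<times> 'a \<Rightarrow> rat"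
  assumes "c \<in> cycles G"
  shows "(\<Sum>p\<in>parcs G. c p * h (snd p)) = 0"
proof -
  have "(\<Sum>p\<in>parcs G. c p * h (snd p)) = (\<Sum>v\<in>V. \<Sum>p | p \<in> parcs G \<and> snd p = v. c p * h (snd p))"
    using arc_snd by (intro sum.group [symmetric] finite_arcs finite_V) auto
  also have "\<dots> = (\<Sum>v\<in>V. h v * boundary G c v)"
  proof (rule sum.cong [OF refl])
    fix v assume "v \<in> V"
    have "{p. p \<in> parcs G \<and> snd p = v} = (\<lambda>u. (u, v)) ` {u. (u, v) \<in> parcs G}"
      by auto
    then show "(\<Sum>p | p \<in> parcs G \<and> snd p = v. c p * h (snd p)) = h v * boundary G c v"
      by (simp add: sum.reindex inj_on_def boundary_def sum_distrib_left mult.commute)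
  qed
  also have "\<dots> = 0"
    using assms by (simp add: cycles_iff)
  finally show ?thesis .
qed

text \<open>Reversing all arcs exchanges tails with heads and negates \<open>c\<close>.\<close>

lemma sum_arcs_fst:
  fixes c :: "'a \<times> 'a \<Rightarrow> rat"
  assumes "c \<in> cycles G"
  shows "(\<Sum>p\<in>parcs G. c p * h (fst p)) = 0"
proof -
  have anti: "c (prod.swap p) = - c p" for p
    using assms edge_chains_antisym [of c G "snd p" "fst p"] by (simp add: cycles_iff prod.swap_def)
  have "bij_betw prod.swap (parcs G) (parcs G)"
    by (rule bij_betw_byWitness [of _ prod.swap]) (auto intro: arc_sym [THEN iffD1])
  then have "(\<Sum>p\<in>parcs G. c p * h (fst p)) = (\<Sum>p\<in>parcs G. c (prod.swap p) * h (fst (prod.swap p)))"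
    by (rule sum.reindex_bij_betw [symmetric])
  also have "\<dots> = - (\<Sum>p\<in>parcs G. c p * h (snd p))"
    by (simp add: anti sum_negf)
  finally show ?thesis using sum_arcs_snd [OF assms] by simp
qed

text \<open>Each undirected edge is counted as two arcs, whence the factor one half. The root paths
  drop out because their coefficients at each vertex add up to boundary values of
  \<open>c\<close>.\<close>

lemma cycle_expansion:
  fixes c :: "'a \<times> 'a \<Rightarrow> rat"
  assumes c: "c \<in> cycles G"
  shows "c = (\<Sum>p\<in>parcs G. (\<lambda>a. c p / 2 * fundamental_cycle (fst p) (snd p) a))"
proof
  fix a :: "'a \<times> 'a"
  obtain x y where a: "a = (x, y)" by fastforce
  have chain: "c \<in> edge_chains G" using c by (simp add: cycles_iff)
  have "(\<Sum>p\<in>parcs G. c p * rat_arc (fst p) (snd p) a) =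
      (\<Sum>p\<in>parcs G. (if p = (x, y) then c p else 0) - (if p = (y, x) then c p else 0))"
    unfolding a
  proof (intro sum.cong refl)
    fix p assume "p \<in> parcs G"
    moreover obtain u v where p: "p = (u, v)" by (cases p)
    ultimately have "u \<noteq> v" using arc_neq by simp
    then show "c p * rat_arc (fst p) (snd p) (x, y) =
        (if p = (x, y) then c p else 0) - (if p = (y, x) then c p else 0)"
      unfolding p fst_conv snd_conv rat_arc_apply [OF \<open>u \<noteq> v\<close>] prod.inject
      by (cases "u = x"; cases "v = y"; cases "u = y"; cases "v = x"; simp)
  qed
  also have "\<dots> = c (x, y) - c (y, x)"
    using edge_chains_support [OF chain] finite_arcs by (simp add: sum_subtractf)
  also have "\<dots> = 2 * c a"
    using edge_chains_antisym [OF chain, of y x] a by simp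
  finally have "(\<Sum>p\<in>parcs G. c p * fundamental_cycle (fst p) (snd p) a) = 2 * c a"
    using sum_arcs_fst [OF c, of "\<lambda>u. root_path u a"] sum_arcs_snd [OF c, of "\<lambda>u. root_path u a"]
    by (simp add: fundamental_cycle_def algebra_simps sum.distrib sum_subtractf)
  then show "c a = (\<Sum>p\<in>parcs G. (\<lambda>a. c p / 2 * fundamental_cycle (fst p) (snd p) a)) a"
    by (simp add: sum_fun_apply flip: sum_divide_distrib)
qed

text \<open>The fundamental cycles of the cotree edges, one orientation chosen for each, form a
  basis of the rational cycle space.\<close>

lemma betti_eq: "betti G = card cotree"
proof -
  interpret chains: vector_space "\<lambda>(k::rat) (c :: 'a \<times> 'a \<Rightarrow> rat) a. k * c a"
    by unfold_locales (auto simp: algebra_simps fun_eq_iff)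
  have "\<exists>p. p \<in> parcs G \<and> e = {fst p, snd p}" if "e \<in> cotree" for e
  proof -
    have "e \<in> E" using that by (simp add: cotree_def)
    then obtain u v where "e = {u, v}" "(u, v) \<in> parcs G"
      by (rule edgeE)
    then show ?thesis by (intro exI [of _ "(u, v)"]) simp
  qed
  then obtain ori where ori': "\<forall>e\<in>cotree. ori e \<in> parcs G \<and> e = {fst (ori e), snd (ori e)}"
    using bchoice [of cotree "\<lambda>e p. p \<in> parcs G \<and> e = {fst p, snd p}"] by blast
  have ori: "ori e \<in> parcs G" "{fst (ori e), snd (ori e)} = e" if "e \<in> cotree" for e
    using ori' that by blast+
  define z where "z = (\<lambda>e. fundamental_cycle (fst (ori e)) (snd (ori e)))"
  \<comment> \<open>Root paths vanish off the tree, so evaluation on the oriented cotree edges gives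
    an identity matrix; injectivity and independence follow.\<close>
  have z_ori: "z e (ori e') = of_bool (e = e')" if e: "e \<in> cotree" "e' \<in> cotree" for e e'
  proof -
    obtain u v where uv: "ori e = (u, v)" "(u, v) \<in> parcs G" "e = {u, v}"
      using ori [OF e(1)] by (metis prod.collapse)
    obtain x y where xy: "ori e' = (x, y)" "(x, y) \<in> parcs G" "e' = {x, y}"
      using ori [OF e(2)] by (metis prod.collapse)
    have "{x, y} \<notin> tree"
      using e(2) xy by (simp add: cotree_def)
    then have "z e (ori e') = rat_arc u v (x, y)"
      using uv xy arc_fst arc_snd by (simp add: z_def fundamental_cycle_def root_path_cotree)
    also have "\<dots> = of_bool (e = e')"
    proof (cases "e = e'")
      case True
      then have "(x, y) = (u, v)" using uv(1) xy(1) by simp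
      then show ?thesis using True arc_neq [OF uv(2)] by (simp add: rat_arc_apply [OF arc_neq [OF uv(2)]])
    next
      case False
      then have "(x, y) \<noteq> (u, v)" "(x, y) \<noteq> (v, u)"
        using uv(3) xy(3) by (auto simp: insert_commute)
      then show ?thesis
        using False by (simp only: rat_arc_apply [OF arc_neq [OF uv(2)]] of_bool_eq)
    qed
    finally show ?thesis .
  qed
  have inj: "inj_on z cotree"
  proof (rule inj_onI)
    fix e e' assume e: "e \<in> cotree" "e' \<in> cotree" and eq: "z e = z e'"
    have "of_bool (e' = e) = (1 :: rat)"
      using z_ori [OF e(1,1)] unfolding eq z_ori [OF e(2,1)] by simp
    then show "e = e'" by (simp split: if_splits)
  qed
  show ?thesis
    unfolding betti_def
  proof (rule chains.dim_unique)
    show "z ` cotree \<subseteq> cycles G"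
    proof
      fix x assume "x \<in> z ` cotree"
      then obtain e where "e \<in> cotree" "x = fundamental_cycle (fst (ori e)) (snd (ori e))"
        unfolding z_def by blast
      then show "x \<in> cycles G"
        using ori(1) [of e] by (simp add: fundamental_cycle_in_cycles)
    qed
    show "chains.independent (z ` cotree)"
    proof (rule chains.independent_if_scalars_zero)
      fix f x assume sum0: "(\<Sum>x\<in>z ` cotree. (\<lambda>a. f x * x a)) = 0" and "x \<in> z ` cotree"
      then obtain e where e: "e \<in> cotree" "x = z e" by blast
      have "0 = (\<Sum>x\<in>z ` cotree. f x * x (ori e))"
        using fun_cong [OF sum0, of "ori e"] by (simp add: sum_fun_apply)
      also have "\<dots> = (\<Sum>e'\<in>cotree. if e' = e then f (z e') else 0)"
        using e by (simp add: sum.reindex [OF inj]) (auto intro!: sum.cong simp: z_ori)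
      also have "\<dots> = f x"
        using e finite_cotree by simp
      finally show "f x = 0" by simp
    qed (simp add: finite_cotree)
    \<comment> \<open>Tree arcs have fundamental cycle zero, and a cotree arc agrees with its chosen
      orientation up to sign.\<close>
    have "fundamental_cycle (fst p) (snd p) \<in> chains.span (z ` cotree)" if p: "p \<in> parcs G" for p
    proof (cases "{fst p, snd p} \<in> tree")
      case True
      then show ?thesis
        using p arc_neq [of "fst p" "snd p"] by (simp add: fundamental_cycle_tree chains.span_zero)
    next
      case False
      then have e: "{fst p, snd p} \<in> cotree"
        using p edge_iff_arc [of "fst p" "snd p"] by (simp add: cotree_def)
      let ?q = "ori {fst p, snd p}"
      have "z {fst p, snd p} \<in> chains.span (z ` cotree)"
        using e by (intro chains.span_base imageI)
      moreover have "{fst p, snd p} = {fst ?q, snd ?q}"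
        using ori(2) [OF e] by simp
      then have "(fst ?q = fst p \<and> snd ?q = snd p) \<or> (fst ?q = snd p \<and> snd ?q = fst p)"
        by (auto simp: doubleton_eq_iff)
      ultimately show ?thesis
        using fundamental_cycle_swap [of "snd p" "fst p"] p arc_neq [of "fst p" "snd p"]
          chains.span_neg [of "z {fst p, snd p}"]
        by (auto simp: z_def)
    qed
    then have span: "(\<Sum>p\<in>parcs G. (\<lambda>a. c p / 2 * fundamental_cycle (fst p) (snd p) a)) \<in> chains.span (z ` cotree)" for c
      by (intro chains.span_sum chains.span_scale)
    show "cycles G \<subseteq> chains.span (z ` cotree)"
    proof
      fix c :: "'a \<times> 'a \<Rightarrow> rat" assume "c \<in> cycles G"
      then show "c \<in> chains.span (z ` cotree)"
        using span [of c] by (simp only: cycle_expansion [symmetric])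
    qed
    show "card (z ` cotree) = card cotree"
      by (rule card_image [OF inj])
  qed
qed

end

section \<open>The cokernel\<close>

text \<open>The trivial case of the cokernel becomes a cyclic group of order 1, so all three cases
  are treated alike.\<close>

lemma integer_mod_group_1_eq: "integer_mod_group 1 = singleton_group 0"
  by (auto simp: integer_mod_group_def singleton_group_def)

lemma mod_hom:
  assumes "k > 0" "\<And>x y. x \<in> carrier M \<Longrightarrow> y \<in> carrier M \<Longrightarrow> g (x \<otimes>\<^bsub>M\<^esub> y) = g x + g y"
  shows "(\<lambda>x. g x mod int k) \<in> hom M (integer_mod_group k)"
  using assms by (intro homI) (auto simp: carrier_integer_mod_group mod_add_eq)

context rooted_regular_graph
begin

text \<open>The order of the cyclic group \<open>C\<close>; for non-bipartite \<open>G\<close> it is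
  the gcd of \<open>d\<close> and 2.\<close>

definition tors :: nat where
  "tors = (if bipartite G then d else if even d then 2 else 1)"

lemma tors_pos: "tors > 0"
  using degree_ge_3 by (simp add: tors_def)

lemma tors_dvd_d: "int tors dvd int d"
  by (auto simp: tors_def)

lemma tors_dvd_2: "\<not> bipartite G \<Longrightarrow> int tors dvd 2"
  by (auto simp: tors_def)

text \<open>A nonzero sign sum is 2 or -2 and occurs only if \<open>G\<close> is not bipartite,
  where \<open>tors\<close> divides 2.\<close>

lemma tors_dvd_edge_sum:
  assumes "e \<in> E"
  shows "int tors dvd (\<Sum>v\<in>e. sg v)"
  using assms
proof (cases rule: sg_edge_sum_cases)
  case (2 s)
  then have "(\<Sum>v\<in>e. sg v) \<noteq> 0"
    by auto
  then have "\<not> bipartite G"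
    using assms bipartite_iff by blast
  then show ?thesis
    unfolding 2(2) by (intro dvd_mult2 tors_dvd_2)
qed simp

definition charge :: "(('a + 'a set) \<times> ('a + 'a set) \<Rightarrow> int) \<Rightarrow> int" where
  "charge c = (\<Sum>v\<in>V. sg v * boundary (sd_graph G) c (Inl v))"

lemma charge_add: "charge (c + c') = charge c + charge c'"
  by (simp add: charge_def boundary_add distrib_left sum.distrib)

lemma charge_sd_map: "c \<in> edge_chains (line_graph G) \<Longrightarrow> charge (sd_map c) = 0"
  by (simp add: charge_def boundary_sd_map_Inl)

lemma boundary_coboundary_Inl:
  assumes "v \<in> V"
  shows "boundary (sd_graph G) (coboundary (sd_graph G) p) (Inl v) =
    int d * p (Inl v) - (\<Sum>e\<in>star v. p (Inr e))"
  using assms by (simp add: boundary_sd_Inl coboundary_def sd_arc_iff sum_subtractf card_star)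

text \<open>In the charge of a bond, the values at original vertices enter with factor
  \<open>d\<close> and those at midpoints with the sign sums of the edges; \<open>tors\<close>
  divides both.\<close>

lemma tors_dvd_charge:
  assumes "c \<in> crit_lattice (sd_graph G)"
  shows "int tors dvd charge c"
proof -
  obtain p where "\<And>x. x \<in> pverts (sd_graph G) \<Longrightarrow>
      boundary (sd_graph G) c x = boundary (sd_graph G) (coboundary (sd_graph G) p) x"
    using assms crit_lattice_iff [OF sym_sd] by blast
  then have "charge c = (\<Sum>v\<in>V. sg v * (int d * p (Inl v) - (\<Sum>e\<in>star v. p (Inr e))))"
    unfolding charge_def by (intro sum.cong refl) (simp add: pverts_sd boundary_coboundary_Inl)
  also have "\<dots> = int d * (\<Sum>v\<in>V. sg v * p (Inl v)) - (\<Sum>v\<in>V. sg v * (\<Sum>e\<in>star v. p (Inr e)))"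
    by (simp add: right_diff_distrib sum_subtractf sum_distrib_left mult.left_commute)
  also have "\<dots> = int d * (\<Sum>v\<in>V. sg v * p (Inl v)) - (\<Sum>e\<in>cotree. (\<Sum>v\<in>e. sg v) * p (Inr e))"
    by (simp only: sum_sg_star_sums)
  also have "int tors dvd \<dots>"
  proof (rule dvd_diff)
    show "int tors dvd int d * (\<Sum>v\<in>V. sg v * p (Inl v))"
      by (rule dvd_mult2 [OF tors_dvd_d])
    show "int tors dvd (\<Sum>e\<in>cotree. (\<Sum>v\<in>e. sg v) * p (Inr e))"
      by (rule dvd_sum) (rule dvd_mult2 [OF tors_dvd_edge_sum], simp add: cotree_def)
  qed
  finally show ?thesis .
qed

section \<open>Prescribing the boundary at the original vertices\<close>

lemma odd_cotree_edge:
  assumes "\<not> bipartite G"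
  obtains g s where "g \<in> cotree" "s * s = 1" "(\<Sum>v\<in>g. sg v) = 2 * s"
proof -
  obtain g where g: "g \<in> E" "(\<Sum>v\<in>g. sg v) \<noteq> 0"
    using assms bipartite_iff by auto
  have "g \<notin> tree"
    using g(2) sg_edge_sum by blast
  with g(1) have "g \<in> cotree"
    by (simp add: cotree_def)
  from g(1) show thesis
  proof (cases rule: sg_edge_sum_cases)
    case (2 s)
    with \<open>g \<in> cotree\<close> show thesis by (rule that)
  qed (use g(2) in simp)
qed

text \<open>A unit at the root itself contributes \<open>d\<close>. If \<open>G\<close> is not
  bipartite, a cotree edge closing an odd cycle contributes 2 or -2 there, and \<open>tors\<close>
  is an integer combination of \<open>d\<close> and 2.\<close>

lemma root_solution:
  obtains a b where "\<And>w. w \<in> V \<Longrightarrow> int d * a w - (\<Sum>e\<in>star w. b e) = of_bool (w = r) * int tors"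
proof (cases "bipartite G")
  case True
  then show thesis
    by (intro that [of "\<lambda>w. of_bool (w = r)" "\<lambda>_. 0"]) (simp add: tors_def)
next
  case False
  then obtain g s where g: "g \<in> cotree" "s * s = 1" "(\<Sum>v\<in>g. sg v) = 2 * s"
    by (rule odd_cotree_edge)
  obtain b where b: "\<And>w. w \<in> V \<Longrightarrow> (\<Sum>e\<in>star w. b e) =
      of_bool (w = r) * (\<Sum>e\<in>cotree. (\<Sum>v\<in>e. sg v) * of_bool (e = g))"
    using extend_from_cotree [of "\<lambda>e. of_bool (e = g)"] by blast
  have "(\<Sum>e\<in>cotree. (\<Sum>v\<in>e. sg v) * of_bool (e = g)) = (\<Sum>e\<in>cotree. if e = g then 2 * s else 0)"
    using g by (intro sum.cong refl) auto
  then have b': "(\<Sum>e\<in>star w. b e) = of_bool (w = r) * (2 * s)" if "w \<in> V" for w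
    using g(1) finite_cotree b [OF that] by simp
  \<comment> \<open>Bezout coefficients: 0 and -1 for even \<open>d\<close>, 1 and
    \<open>d div 2\<close> for odd \<open>d\<close>.\<close>
  obtain x y where xy: "int tors = int d * x - 2 * y"
  proof (cases "even d")
    case True
    then show ?thesis using False by (intro that [of 0 "-1"]) (simp add: tors_def)
  next
    case odd: False
    then obtain m where "d = 2 * m + 1" by (rule oddE)
    then have "int d = 2 * int m + 1" by simp
    moreover have "tors = 1" using False odd by (simp add: tors_def)
    ultimately show ?thesis by (intro that [of 1 "int m"]) simp
  qed
  show thesis
  proof (rule that)
    fix w assume w: "w \<in> V"
    have "(\<Sum>e\<in>star w. y * s * b e) = of_bool (w = r) * (2 * y * (s * s))"
      by (simp add: b' [OF w] flip: sum_distrib_left)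
    then show "int d * (of_bool (w = r) * x) - (\<Sum>e\<in>star w. y * s * b e) = of_bool (w = r) * int tors"
      by (simp add: xy g(2))
  qed
qed

text \<open>Paths transport \<open>h\<close> to the root. What remains there is its signed total, a
  multiple of \<open>tors\<close>, which a multiple of \<open>root_solution\<close>
  supplies.\<close>

lemma boundary_solution:
  assumes "int tors dvd (\<Sum>v\<in>V. sg v * h v)"
  obtains a b where "\<And>w. w \<in> V \<Longrightarrow> int d * a w - (\<Sum>e\<in>star w. b e) = h w"
proof -
  obtain a b where ab: "\<And>w. w \<in> V \<Longrightarrow> int d * a w - (\<Sum>e\<in>star w. b e) = of_bool (w = r) * int tors"
    by (rule root_solution) blast
  obtain m where m: "(\<Sum>v\<in>V. sg v * h v) = int tors * m"
    using assms by (rule dvdE)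
  show thesis
  proof (rule that)
    fix w assume w: "w \<in> V"
    have "(\<Sum>e\<in>star w. m * b e - (\<Sum>v\<in>V. h v * path v e)) =
        m * (\<Sum>e\<in>star w. b e) - (h w - of_bool (w = r) * (int tors * m))"
      unfolding sum_subtractf sum_star_paths [OF w] m by (simp add: sum_distrib_left)
    then show "int d * (m * a w) - (\<Sum>e\<in>star w. m * b e - (\<Sum>v\<in>V. h v * path v e)) = h w"
      using arg_cong [OF ab [OF w], of "\<lambda>x. m * x"] by (simp add: algebra_simps)
  qed
qed

text \<open>A bond with the same boundary as \<open>c\<close> at the original vertices is
  subtracted; the rest lifts to the line graph.\<close>

lemma charge_in_image:
  assumes c: "c \<in> edge_chains (sd_graph G)" and "int tors dvd charge c"
  obtains c' where "c' \<in> edge_chains (line_graph G)" "c - sd_map c' \<in> crit_lattice (sd_graph G)"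
proof -
  obtain a b where ab: "\<And>w. w \<in> V \<Longrightarrow>
      int d * a w - (\<Sum>e\<in>star w. b e) = boundary (sd_graph G) c (Inl w)"
    using boundary_solution [OF assms(2) [unfolded charge_def]] by blast
  define t where "t = coboundary (sd_graph G) (case_sum a b)"
  have t: "t \<in> edge_chains (sd_graph G)" "t \<in> crit_lattice (sd_graph G)"
    by (simp_all add: t_def coboundary_edge_chains coboundary_in_crit_lattice sym_sd)
  have "sd_map (star_lift (c - t)) = c - t"
    using ab by (intro sd_map_star_lift diff_edge_chains c t)
      (simp add: boundary_diff t_def boundary_coboundary_Inl)
  then have "c - sd_map (star_lift (c - t)) \<in> crit_lattice (sd_graph G)"
    using t by simp
  then show thesis
    by (rule that [OF star_lift_edge_chains])
qed

lemma cokernel_map: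
  assumes f: "\<And>c. c \<in> edge_chains (line_graph G) \<Longrightarrow>
      f (crit_class (line_graph G) c) = crit_class (sd_graph G) (sd_map c)"
  obtains p where "p \<in> epi (critical_group (sd_graph G)) (integer_mod_group tors)"
    and "f ` carrier (critical_group (line_graph G)) =
      kernel (critical_group (sd_graph G)) (integer_mod_group tors) p"
proof -
  let ?h = "\<lambda>c. charge c mod int tors"
  have "?h \<in> hom (chain_group (sd_graph G)) (integer_mod_group tors)"
    by (rule mod_hom) (simp_all add: tors_pos charge_add)
  then interpret h: group_hom "chain_group (sd_graph G)" "integer_mod_group tors" ?h
    by (simp add: group_hom_def group_hom_axioms_def group_chain_group)
  have "crit_lattice (sd_graph G) \<subseteq> kernel (chain_group (sd_graph G)) (integer_mod_group tors) ?h"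
    using tors_dvd_charge crit_lattice_iff [OF sym_sd] by (auto simp: kernel_def)
  then obtain p where hom: "p \<in> hom (critical_group (sd_graph G)) (integer_mod_group tors)"
    and p: "\<And>c. c \<in> edge_chains (sd_graph G) \<Longrightarrow> p (crit_class (sd_graph G) c) = ?h c"
    using h.FactGroup_universal_kernel [OF crit_lattice_normal [OF sym_sd]]
    unfolding critical_group_def crit_class_def carrier_chain_group by blast
  have "star r \<noteq> {}"
    using card_star [OF root] degree_ge_3 by auto
  then obtain e where e: "e \<in> star r" by blast
  \<comment> \<open>Surjectivity: a single flag at the root with value \<open>m\<close> has charge
    \<open>m\<close>, since \<open>sg r = 1\<close>.\<close>
  have charge_flag: "charge (flag_chain (\<lambda>e' v. if e' = e \<and> v = r then m else 0)) = m" for m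
  proof -
    have "boundary (sd_graph G) (flag_chain (\<lambda>e' v. if e' = e \<and> v = r then m else 0)) (Inl v) =
        (if v = r then m else 0)" for v
      using e by (auto simp: boundary_sd_Inl finite_star)
    then have "charge (flag_chain (\<lambda>e' v. if e' = e \<and> v = r then m else 0)) = (\<Sum>v\<in>V. if v = r then m else 0)"
      unfolding charge_def by (intro sum.cong refl) (simp add: sg_root)
    then show ?thesis
      using root finite_V by simp
  qed
  have "p ` carrier (critical_group (sd_graph G)) = carrier (integer_mod_group tors)"
  proof
    show "p ` carrier (critical_group (sd_graph G)) \<subseteq> carrier (integer_mod_group tors)"
      using hom by (auto simp: hom_def)
    show "carrier (integer_mod_group tors) \<subseteq> p ` carrier (critical_group (sd_graph G))"
    proof
      fix m assume "m \<in> carrier (integer_mod_group tors)"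
      then have "m mod int tors = m"
        using tors_pos by (simp add: carrier_integer_mod_group)
      then have "m = p (crit_class (sd_graph G) (flag_chain (\<lambda>e' v. if e' = e \<and> v = r then m else 0)))"
        by (simp add: p flag_chain_edge_chains charge_flag)
      then show "m \<in> p ` carrier (critical_group (sd_graph G))"
        unfolding carrier_critical_group using flag_chain_edge_chains by blast
    qed
  qed
  then have "p \<in> epi (critical_group (sd_graph G)) (integer_mod_group tors)"
    using hom by (simp add: epi_def)
  moreover have "f ` carrier (critical_group (line_graph G)) =
      kernel (critical_group (sd_graph G)) (integer_mod_group tors) p"
  proof
    show "f ` carrier (critical_group (line_graph G)) \<subseteq>
        kernel (critical_group (sd_graph G)) (integer_mod_group tors) p"
      using f p charge_sd_map sd_map_edge_chains
      by (auto simp: kernel_def carrier_critical_group)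
    show "kernel (critical_group (sd_graph G)) (integer_mod_group tors) p \<subseteq>
        f ` carrier (critical_group (line_graph G))"
    proof
      fix X assume "X \<in> kernel (critical_group (sd_graph G)) (integer_mod_group tors) p"
      then obtain c where c: "c \<in> edge_chains (sd_graph G)" "X = crit_class (sd_graph G) c"
        and "p X = 0"
        by (auto simp: kernel_def carrier_critical_group)
      then have "int tors dvd charge c"
        using p by (simp add: dvd_eq_mod_eq_0)
      then obtain c' where c': "c' \<in> edge_chains (line_graph G)" "c - sd_map c' \<in> crit_lattice (sd_graph G)"
        using charge_in_image [OF c(1)] by blast
      then have "X = f (crit_class (line_graph G) c')"
        using f c crit_class_eq_iff [OF sym_sd c(1) sd_map_edge_chains] by simp
      then show "X \<in> f ` carrier (critical_group (line_graph G))"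
        unfolding carrier_critical_group using c'(1) by blast
    qed
  qed
  ultimately show thesis by (rule that)
qed

text \<open>After extension from the cotree only the star sum at the root can be nonzero, and the
  hypothesis makes it divisible by \<open>d\<close>.\<close>

lemma extension_balanced:
  assumes "int d dvd (\<Sum>e\<in>cotree. (\<Sum>v\<in>e. sg v) * y e)"
  obtains b where "b \<in> balanced" "\<And>e. e \<in> cotree \<Longrightarrow> b e = y e"
proof -
  obtain b where "\<And>e. e \<in> cotree \<Longrightarrow> b e = y e"
    and "\<And>w. w \<in> V \<Longrightarrow> (\<Sum>e\<in>star w. b e) = of_bool (w = r) * (\<Sum>e\<in>cotree. (\<Sum>v\<in>e. sg v) * y e)"
    using extend_from_cotree [of y] by blast
  then show thesis
    using assms by (intro that [of b]) (simp_all add: balanced_def)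
qed

subsection \<open>Coordinates on the kernel\<close>

text \<open>Weighing the star sums by \<open>sg\<close> yields the only relation between the values of a balanced
  function on the cotree edges: \<open>d\<close> divides \<open>2 * eta e0 b\<close>, where \<open>eta\<close> below only
  involves the cotree edges that close an odd cycle.\<close>

definition odd_sign :: "'a set \<Rightarrow> int" where
  "odd_sign e = (\<Sum>v\<in>e. sg v) div 2"

definition eta :: "'a set \<Rightarrow> ('a set \<Rightarrow> int) \<Rightarrow> int" where
  "eta e0 b = (\<Sum>e\<in>cotree. odd_sign e * (b e - b e0))"

lemma odd_sign:
  assumes "e \<in> cotree"
  shows "(\<Sum>v\<in>e. sg v) = 2 * odd_sign e"
proof -
  have "e \<in> E" using assms by (simp add: cotree_def)
  then show ?thesis
    by (cases rule: sg_edge_sum_cases) (simp_all add: odd_sign_def)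
qed

lemma sum_odd_sign: "(\<Sum>e\<in>cotree. (\<Sum>v\<in>e. sg v) * y e) = 2 * (\<Sum>e\<in>cotree. odd_sign e * y e)"
  unfolding sum_distrib_left by (intro sum.cong refl) (simp add: odd_sign)

lemma eta_add: "eta e0 (b + b') = eta e0 b + eta e0 b'"
  by (simp add: eta_def algebra_simps sum.distrib sum_subtractf)

lemma balanced_diff_const:
  assumes "b \<in> balanced"
  shows "(\<lambda>e. b e - k) \<in> balanced"
  using assms by (auto simp: balanced_def sum_subtractf card_star)

text \<open>\<open>2 * eta e0 b\<close> is the signed total of the star sums of \<open>b\<close>
  shifted by the constant \<open>b e0\<close>, and the shift is again balanced.\<close>

lemma d_dvd_2_eta:
  assumes "b \<in> balanced"
  shows "int d dvd 2 * eta e0 b"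
proof -
  have "2 * eta e0 b = (\<Sum>v\<in>V. sg v * (\<Sum>e\<in>star v. b e - b e0))"
    unfolding eta_def sum_sg_star_sums sum_odd_sign ..
  also have "int d dvd \<dots>"
    using balanced_diff_const [OF assms, of "b e0"]
    by (intro dvd_sum) (simp add: balanced_def dvd_mult)
  finally show ?thesis .
qed

lemma other_cotree_edge:
  assumes "e \<in> cotree"
  obtains e' where "e' \<in> cotree" "e \<noteq> e'"
proof -
  have "\<not> cotree \<subseteq> {e}"
    using card_cotree card_mono [of "{e}" cotree] by auto
  then show thesis using that by blast
qed

text \<open>Differences from \<open>b e0\<close> are used because constants are divided out. All
  other cotree edges except \<open>g\<close> carry a free value modulo \<open>d\<close>, while
  \<open>\<chi>\<close>, read modulo \<open>tors\<close>, replaces the value at \<open>g\<close>,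
  where the relation is absorbed. For bipartite \<open>G\<close> there is no relation, and
  \<open>\<chi>\<close> is the difference at \<open>g\<close> itself.\<close>

lemma coordinates:
  obtains e0 g \<chi> where "e0 \<in> cotree" "g \<in> cotree" "e0 \<noteq> g"
    and "\<And>b b'. b \<in> balanced \<Longrightarrow> b' \<in> balanced \<Longrightarrow> \<chi> (b + b') = (\<chi> b + \<chi> b' :: int)"
    and "\<And>b. b \<in> balanced \<Longrightarrow> (\<And>e. e \<in> cotree - {g} \<Longrightarrow> int d dvd b e - b e0) \<Longrightarrow>
      int tors dvd \<chi> b \<longleftrightarrow> int d dvd b g - b e0"
    and "\<And>y c. y e0 = 0 \<Longrightarrow> \<exists>b\<in>balanced. (\<forall>e\<in>cotree - {g}. b e = y e) \<and> \<chi> b = c"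
proof (cases "bipartite G")
  case True
  have "cotree \<noteq> {}"
    using card_cotree by auto
  then obtain e0 where e0: "e0 \<in> cotree"
    by blast
  obtain g where g: "g \<in> cotree" "e0 \<noteq> g"
    by (rule other_cotree_edge [OF e0])
  have zero: "(\<Sum>v\<in>e. sg v) = 0" if "e \<in> cotree" for e
    using True that by (simp add: bipartite_iff cotree_def)
  show thesis
  proof (rule that [OF e0 g, of "\<lambda>b. b g - b e0"])
    fix y :: "'a set \<Rightarrow> int" and c
    assume "y e0 = 0"
    obtain b where "b \<in> balanced" "\<And>e. e \<in> cotree \<Longrightarrow> b e = (y(g := c)) e"
      using extension_balanced [of "y(g := c)"] zero by auto
    then show "\<exists>b\<in>balanced. (\<forall>e\<in>cotree - {g}. b e = y e) \<and> b g - b e0 = c"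
      using e0 g \<open>y e0 = 0\<close> by (intro bexI [of _ b]) auto
  qed (use True in \<open>auto simp: tors_def\<close>)
next
  case False
  obtain g s where g: "g \<in> cotree" "s * s = 1" "(\<Sum>v\<in>g. sg v) = 2 * s"
    by (rule odd_cotree_edge [OF False])
  then have sign_g: "odd_sign g = s"
    by (simp add: odd_sign_def)
  obtain e0 where e0: "e0 \<in> cotree" "g \<noteq> e0"
    by (rule other_cotree_edge [OF g(1)])
  \<comment> \<open>For balanced \<open>b\<close> the division is exact: for even \<open>d\<close>,
    \<open>tors\<close> is 2 and \<open>d\<close> divides \<open>2 * eta\<close>; for odd
    \<open>d\<close>, it already divides \<open>eta\<close>.\<close>
  define \<chi> where "\<chi> = (\<lambda>b. int tors * eta e0 b div int d)"
  have d: "int d \<noteq> 0"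
    using degree_ge_3 by simp
  have \<chi>: "int d * \<chi> b = int tors * eta e0 b" if "b \<in> balanced" for b
  proof -
    have "int d dvd int tors * eta e0 b"
    proof (cases "even d")
      case True
      then show ?thesis
        using False d_dvd_2_eta [OF that] by (simp add: tors_def)
    next
      case odd: False
      then have "coprime (int d) 2" by simp
      then have "int d dvd eta e0 b"
        using d_dvd_2_eta [OF that] coprime_dvd_mult_right_iff by blast
      then show ?thesis by simp
    qed
    then show ?thesis by (simp add: \<chi>_def)
  qed
  have eta_split: "eta e0 b = s * (b g - b e0) + (\<Sum>e\<in>cotree - {g}. odd_sign e * (b e - b e0))" for b
    unfolding eta_def by (subst sum.remove [OF finite_cotree g(1)]) (simp add: sign_g)
  show thesis
  proof (rule that [OF e0(1) g(1) e0(2) [symmetric], of \<chi>])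
    fix b b' assume b: "b \<in> balanced" "b' \<in> balanced"
    then have "b + b' \<in> balanced"
      using group.subgroup_self monoid.m_closed [OF group.is_monoid [OF group_balanced_group]] by simp
    then have "int d * \<chi> (b + b') = int d * (\<chi> b + \<chi> b')"
      using b by (simp add: \<chi> eta_add distrib_left)
    then show "\<chi> (b + b') = \<chi> b + \<chi> b'"
      using d by simp
  next
    fix b assume b: "b \<in> balanced" and rest: "\<And>e. e \<in> cotree - {g} \<Longrightarrow> int d dvd b e - b e0"
    \<comment> \<open>After multiplication by \<open>d\<close>, the right side becomes
      \<open>tors * eta\<close>, and \<open>tors\<close> cancels.\<close>
    have "int tors dvd \<chi> b \<longleftrightarrow> int d * int tors dvd int d * \<chi> b"
      using d by simp
    also have "\<dots> \<longleftrightarrow> int d dvd eta e0 b"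
      unfolding \<chi> [OF b] using tors_pos by (simp add: mult.commute [of "int d"])
    also have "\<dots> \<longleftrightarrow> int d dvd s * (b g - b e0)"
      unfolding eta_split using rest by (intro dvd_add_left_iff dvd_sum dvd_mult)
    also have "\<dots> \<longleftrightarrow> int d dvd b g - b e0"
    proof
      assume "int d dvd s * (b g - b e0)"
      then have "int d dvd s * (s * (b g - b e0))" by (rule dvd_mult)
      then show "int d dvd b g - b e0" using g(2) by (simp flip: mult.assoc)
    qed (rule dvd_mult)
    finally show "int tors dvd \<chi> b \<longleftrightarrow> int d dvd b g - b e0" .
  next
    fix y :: "'a set \<Rightarrow> int" and c assume y: "y e0 = 0"
    obtain q where q: "int d = int tors * q" using tors_dvd_d by (rule dvdE)
    \<comment> \<open>The coefficient of \<open>g\<close> is \<open>s\<close>, its own inverse, so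
      the value at \<open>g\<close> can be solved for to make the odd sum equal
      \<open>q * c\<close>. With \<open>q = d / tors\<close> this sum yields
      \<open>\<chi> = c\<close>.\<close>
    define y' where "y' = y(g := s * (q * c - (\<Sum>e\<in>cotree - {g}. odd_sign e * y e)))"
    have y'_sum: "(\<Sum>e\<in>cotree. odd_sign e * y' e) = q * c"
    proof -
      have "(\<Sum>e\<in>cotree. odd_sign e * y' e) =
          (s * s) * (q * c - (\<Sum>e\<in>cotree - {g}. odd_sign e * y e)) + (\<Sum>e\<in>cotree - {g}. odd_sign e * y' e)"
        by (subst sum.remove [OF finite_cotree g(1)]) (simp add: sign_g y'_def)
      also have "(\<Sum>e\<in>cotree - {g}. odd_sign e * y' e) = (\<Sum>e\<in>cotree - {g}. odd_sign e * y e)"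
        by (intro sum.cong refl) (simp add: y'_def)
      finally show ?thesis by (simp add: g(2))
    qed
    have "int d dvd 2 * (q * c)"
    proof -
      have "int tors * q dvd 2 * q"
        by (rule mult_dvd_mono [OF tors_dvd_2 [OF False] dvd_refl])
      then show ?thesis by (simp add: q flip: mult.assoc)
    qed
    then obtain b where b: "b \<in> balanced" "\<And>e. e \<in> cotree \<Longrightarrow> b e = y' e"
      using extension_balanced [of y'] unfolding sum_odd_sign y'_sum by blast
    have "b e0 = 0"
      using b(2) [OF e0(1)] e0 y by (simp add: y'_def)
    then have "eta e0 b = q * c"
      unfolding eta_def y'_sum [symmetric] by (intro sum.cong refl) (simp add: b(2))
    then have "int d * \<chi> b = int d * c"
      using \<chi> [OF b(1)] q by simp
    then have "\<chi> b = c" using d by simp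
    then show "\<exists>b\<in>balanced. (\<forall>e\<in>cotree - {g}. b e = y e) \<and> \<chi> b = c"
      using b by (intro bexI [of _ b]) (auto simp: y'_def)
  qed
qed

text \<open>The coordinates are the differences from \<open>b e0\<close> modulo \<open>d\<close> at
  the cotree edges other than \<open>e0\<close> and \<open>g\<close>, which explains the exponent,
  and \<open>\<chi>\<close> modulo \<open>tors\<close>. If all vanish, \<open>b - b e0\<close> is
  divisible by \<open>d\<close> on the cotree, hence on every edge.\<close>

lemma balanced_quotient:
  obtains q where
    "group_hom balanced_group
      (product_group {..<betti G - 2} (\<lambda>_. integer_mod_group d) \<times>\<times> integer_mod_group tors) q"
    and "q ` balanced =
      carrier (product_group {..<betti G - 2} (\<lambda>_. integer_mod_group d) \<times>\<times> integer_mod_group tors)"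
    and "\<And>b. b \<in> balanced \<Longrightarrow>
      q b = \<one>\<^bsub>product_group {..<betti G - 2} (\<lambda>_. integer_mod_group d) \<times>\<times> integer_mod_group tors\<^esub>
      \<longleftrightarrow> (\<exists>k. \<forall>e\<in>E. int d dvd b e - k)"
proof -
  let ?n = "betti G - 2"
  let ?A = "product_group {..<?n} (\<lambda>_. integer_mod_group d) \<times>\<times> integer_mod_group tors"
  obtain e0 g \<chi> where e0: "e0 \<in> cotree" and g: "g \<in> cotree" and neq: "e0 \<noteq> g"
    and \<chi>_add: "\<And>b b'. b \<in> balanced \<Longrightarrow> b' \<in> balanced \<Longrightarrow> \<chi> (b + b') = (\<chi> b + \<chi> b' :: int)"
    and \<chi>_dvd: "\<And>b. b \<in> balanced \<Longrightarrow> (\<And>e. e \<in> cotree - {g} \<Longrightarrow> int d dvd b e - b e0) \<Longrightarrow>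
      int tors dvd \<chi> b \<longleftrightarrow> int d dvd b g - b e0"
    and \<chi>_surj: "\<And>y c. y e0 = 0 \<Longrightarrow> \<exists>b\<in>balanced. (\<forall>e\<in>cotree - {g}. b e = y e) \<and> \<chi> b = c"
    by (rule coordinates) blast
  have "card (cotree - {e0, g}) = ?n"
    using e0 g neq finite_cotree by (simp add: betti_eq card_Diff_subset)
  then obtain idx where idx: "bij_betw idx {..<?n} (cotree - {e0, g})"
    using ex_bij_betw_nat_finite [of "cotree - {e0, g}"] finite_cotree
    by (auto simp: atLeast0LessThan)
  have d: "int d > 0" "d \<noteq> 0"
    using degree_ge_3 by auto
  define q where "q = (\<lambda>b. (\<lambda>i\<in>{..<?n}. (b (idx i) - b e0) mod int d, \<chi> b mod int tors))"
  have carrier_d: "carrier (integer_mod_group d) = {0..<int d}"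
    and carrier_tors: "carrier (integer_mod_group tors) = {0..<int tors}"
    using d tors_pos by (simp_all add: carrier_integer_mod_group)
  have closed: "q b \<in> carrier ?A" for b
    using d tors_pos by (auto simp: q_def carrier_d carrier_tors)
  have "q \<in> hom balanced_group ?A"
  proof (rule homI)
    fix b b' assume "b \<in> carrier balanced_group" "b' \<in> carrier balanced_group"
    then have "\<chi> (b + b') = \<chi> b + \<chi> b'"
      by (simp add: \<chi>_add)
    moreover have "(b (idx i) + b' (idx i) - (b e0 + b' e0)) mod int d =
        ((b (idx i) - b e0) mod int d + (b' (idx i) - b' e0) mod int d) mod int d" for i
      by (simp add: mod_add_eq algebra_simps)
    ultimately show "q (b \<otimes>\<^bsub>balanced_group\<^esub> b') = q b \<otimes>\<^bsub>?A\<^esub> q b'"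
      by (auto simp: q_def mod_add_eq fun_eq_iff)
  qed (rule closed)
  then have hom: "group_hom balanced_group ?A q"
    by (simp add: group_hom_def group_hom_axioms_def group_balanced_group DirProd_group)
  have surj: "q ` balanced = carrier ?A"
  proof
    show "q ` balanced \<subseteq> carrier ?A"
      using closed by blast
    show "carrier ?A \<subseteq> q ` balanced"
    proof
      fix x assume x: "x \<in> carrier ?A"
      obtain t c where tc: "x = (t, c)" by fastforce
      have t: "t \<in> {..<?n} \<rightarrow>\<^sub>E {0..<int d}" and c: "c \<in> {0..<int tors}"
        using x by (simp_all add: tc carrier_d carrier_tors)
      define y where "y = (\<lambda>e. if e = e0 then 0 else t (inv_into {..<?n} idx e))"
      obtain b where b: "b \<in> balanced" "\<And>e. e \<in> cotree - {g} \<Longrightarrow> b e = y e" "\<chi> b = c"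
        using \<chi>_surj [of y c] by (auto simp: y_def)
      have "b (idx i) - b e0 = t i" if i: "i < ?n" for i
      proof -
        have "idx i \<in> cotree - {e0, g}"
          using bij_betwE [OF idx] i by simp
        moreover have "inv_into {..<?n} idx (idx i) = i"
          using idx i by (simp add: bij_betw_def)
        ultimately show ?thesis
          using b(2) [of "idx i"] b(2) [of e0] e0 neq by (simp add: y_def)
      qed
      moreover have "t i mod int d = t i" if "i < ?n" for i
        using PiE_mem [OF t, of i] that by simp
      \<comment> \<open>Elements of the product are \<open>undefined\<close> off the index set, as
        is the restriction in \<open>q\<close>.\<close>
      moreover have "t i = undefined" if "\<not> i < ?n" for i
        using PiE_arb [OF t, of i] that by simp
      moreover have "c mod int tors = c"
        using c by simp
      ultimately have "q b = x"
        unfolding q_def tc b(3) by (auto simp: fun_eq_iff restrict_def)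
      then show "x \<in> q ` balanced"
        using b(1) by blast
    qed
  qed
  have ker: "q b = \<one>\<^bsub>?A\<^esub> \<longleftrightarrow> (\<exists>k. \<forall>e\<in>E. int d dvd b e - k)" if b: "b \<in> balanced" for b
  proof -
    have "q b = \<one>\<^bsub>?A\<^esub> \<longleftrightarrow> (\<forall>i<?n. int d dvd b (idx i) - b e0) \<and> int tors dvd \<chi> b"
      by (auto simp: q_def fun_eq_iff restrict_def dvd_eq_mod_eq_0)
    also have "(\<forall>i<?n. int d dvd b (idx i) - b e0) \<longleftrightarrow> (\<forall>e\<in>cotree - {e0, g}. int d dvd b e - b e0)"
      unfolding bij_betw_imp_surj_on [OF idx, symmetric] by auto
    \<comment> \<open>At \<open>e0\<close> the difference is 0, so this edge may be
      included.\<close>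
    also have "\<dots> \<longleftrightarrow> (\<forall>e\<in>cotree - {g}. int d dvd b e - b e0)"
      by (metis (no_types, lifting) Diff_iff cancel_comm_monoid_add_class.diff_cancel dvd_0_right insert_iff)
    also have "\<dots> \<and> int tors dvd \<chi> b \<longleftrightarrow> (\<forall>e\<in>cotree. int d dvd b e - b e0)"
      using \<chi>_dvd [OF b] g by blast
    also have "\<dots> \<longleftrightarrow> (\<forall>e\<in>E. int d dvd b e - b e0)"
      using dvd_all_edges [of "int d" "\<lambda>e. b e - b e0"] balanced_diff_const [OF b, of "b e0"]
      by (auto simp: balanced_def cotree_def)
    also have "\<dots> \<longleftrightarrow> (\<exists>k. \<forall>e\<in>E. int d dvd b e - k)"
    proof
      assume "\<exists>k. \<forall>e\<in>E. int d dvd b e - k"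
      then obtain k where k: "\<forall>e\<in>E. int d dvd b e - k" ..
      have e0E: "e0 \<in> E" using e0 by (simp add: cotree_def)
      show "\<forall>e\<in>E. int d dvd b e - b e0"
      proof
        fix e assume "e \<in> E"
        then show "int d dvd b e - b e0"
          using dvd_diff [OF k [rule_format, of e] k [rule_format, OF e0E]] by simp
      qed
    qed blast
    finally show ?thesis .
  qed
  show thesis
    using hom surj ker by (rule that)
qed

end

section \<open>Assembling the exact sequence\<close>

theorem theorem1p3:
  fixes G :: "'a pair_pre_digraph" and d :: nat and C :: "int monoid"
  assumes "pair_graph G"
    and "Digraph_Component.connected (with_proj G)"
    and "regular d G"
    and "d \<ge> 3"
    and C: "C = (if bipartite G then integer_mod_group d
                 else if even d then integer_mod_group 2
                 else singleton_group 0)"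
  shows "\<exists>\<phi> f i p.
      \<phi> \<in> hom (chain_group (line_graph G)) (chain_group (sd_graph G)) \<and>
      (\<forall>u v w. (u, v) \<in> parcs G \<and> (v, w) \<in> parcs G \<and> u \<noteq> w \<longrightarrow>
         \<phi> (arc_chain {u, v} {v, w}) =
           arc_chain (Inr {u, v}) (Inl v) + arc_chain (Inl v) (Inr {v, w})) \<and>
      f \<in> hom (critical_group (line_graph G)) (critical_group (sd_graph G)) \<and>
      (\<forall>c \<in> edge_chains (line_graph G). f (crit_class (line_graph G) c) = crit_class (sd_graph G) (\<phi> c)) \<and>
      i \<in> mon (product_group {..<betti G - 2} (\<lambda>_. integer_mod_group d) \<times>\<times> C)
              (critical_group (line_graph G)) \<and>
      i ` carrier (product_group {..<betti G - 2} (\<lambda>_. integer_mod_group d) \<times>\<times> C) =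
        kernel (critical_group (line_graph G)) (critical_group (sd_graph G)) f \<and>
      p \<in> epi (critical_group (sd_graph G)) C \<and>
      f ` carrier (critical_group (line_graph G)) = kernel (critical_group (sd_graph G)) C p"
proof -
  interpret regular_graph G d
    using assms by (intro regular_graph.intro)
  obtain r dep par where "rooted_regular_graph G d r dep par"
    by (rule rooted_tree_exists)
  then interpret rooted_regular_graph G d r dep par .
  have C_eq: "C = integer_mod_group tors"
    by (simp add: C tors_def flip: integer_mod_group_1_eq)
  let ?A = "product_group {..<betti G - 2} (\<lambda>_. integer_mod_group d) \<times>\<times> integer_mod_group tors"
  obtain f where f: "f \<in> hom (critical_group (line_graph G)) (critical_group (sd_graph G))"
      "\<And>c. c \<in> edge_chains (line_graph G) \<Longrightarrow>
        f (crit_class (line_graph G) c) = crit_class (sd_graph G) (sd_map c)"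
    and ker: "kernel (critical_group (line_graph G)) (critical_group (sd_graph G)) f = kernel_class ` balanced"
    by (rule induced_hom) (rule that)
  obtain p where p: "p \<in> epi (critical_group (sd_graph G)) (integer_mod_group tors)"
      "f ` carrier (critical_group (line_graph G)) =
        kernel (critical_group (sd_graph G)) (integer_mod_group tors) p"
    using cokernel_map [OF f(2)] by blast
  obtain q where q: "group_hom balanced_group ?A q" "q ` balanced = carrier ?A"
    "\<And>b. b \<in> balanced \<Longrightarrow> q b = \<one>\<^bsub>?A\<^esub> \<longleftrightarrow> (\<exists>k. \<forall>e\<in>E. int d dvd b e - k)"
    by (rule balanced_quotient) (rule that)
  have "group_hom balanced_group (critical_group (line_graph G)) kernel_class"
    by (simp add: group_hom_def group_hom_axioms_def group_balanced_group group_critical_group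
        sym_line kernel_class_hom)
  \<comment> \<open>The product and the kernel of \<open>f\<close> are both quotients of
    \<open>balanced_group\<close> by the functions that are constant modulo \<open>d\<close> on the
    edges.\<close>
  with q(1) obtain i where i: "i \<in> mon ?A (critical_group (line_graph G))"
    "i ` carrier ?A = kernel_class ` carrier balanced_group"
    by (rule mon_from_common_kernel) (use q(2,3) kernel_class_eq_one_iff in simp_all)
  show ?thesis
    unfolding C_eq using sd_map_hom sd_map_arc_chain f ker i p
    by (intro exI [of _ sd_map] exI [of _ f] exI [of _ i] exI [of _ p]) simp
qed

end
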